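(* Let $K$ be a nonzero commutative, associative and unital ring, let $E_1$ and $E_2$ be directed graphs, and let $H$ be any commutative Hopf $K$-algebra (in particular, any commutative group $K$-algebra). Then $L_H(E_1)\cong L_H(E_2)$ as $H$-algebras if and only if $L_K(E_1)\cong L_K(E_2)$ as $K$-algebras.
   Context: A directed graph $E=(E^0,E^1,r,s)$ consists of two sets $E^0$ (vertices) and $E^1$ (edges) and functions $r,s\colon E^1\to E^0$. A vertex $v$ is regular if $s^{-1}(v)$ is a finite non-empty set; $\mathrm{Reg}(E)$ is the set of regular vertices. For a commutative unital ring $R$, the Leavitt path algebra $L_R(E)$ is the free (associative, not necessarily unital) $R$-algebra generated by $E^0\cup E^1\cup\{e^*: e\in E^1\}$ subject to the relations: (V) $vw=\delta_{v,w}v$ for $v,w\in E^0$; (E1) $s(e)e=er(e)=e$ for $e\in E^1$; (E2) $r(e)e^*=e^*s(e)=e^*$ for $e\in E^1$; (CK1) $e^*f=\delta_{e,f}r(e)$ for $e,f\in E^1$; (CK2) $v=\sum_{e\in s^{-1}(v)}ee^*$ for every $v\in\mathrm{Reg}(E)$. *)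

theory Defs
  imports "HOL-Algebra.Module" "HOL-Algebra.QuotRing" "Graph_Theory.Digraph"
begin

section \<open>Monoid algebras, generated ideals and quotient algebras\<close>

text \<open>
  Algebras over a ring \<open>R\<close> are values of the record type \<^type>\<open>module\<close>.  For algebras that need not
  be unital, the field \<open>one\<close> of the record carries no meaning and is never used.
\<close>

text \<open>
  \<open>R[G]\<close>: finitely supported functions from \<open>G\<close> to \<open>R\<close> with convolution.  For a group \<open>G\<close> it is the
  group algebra.  The definition also makes sense for a semigroup \<open>G\<close>, where it gives the (possibly
  non-unital) semigroup algebra.
\<close>

definition monoid_algebra ::
  "('r, 'm) ring_scheme \<Rightarrow> ('g, 'n) monoid_scheme \<Rightarrow> ('r, 'g \<Rightarrow> 'r) module" where
  "monoid_algebra R G =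
    \<lparr>carrier = {p. (\<forall>g\<in>carrier G. p g \<in> carrier R) \<and> (\<forall>g. g \<notin> carrier G \<longrightarrow> p g = \<zero>\<^bsub>R\<^esub>) \<and>
                   finite {g. p g \<noteq> \<zero>\<^bsub>R\<^esub>}},
     mult = (\<lambda>p q g. finsum R (\<lambda>(a, b). p a \<otimes>\<^bsub>R\<^esub> q b)
              {(a, b). p a \<noteq> \<zero>\<^bsub>R\<^esub> \<and> q b \<noteq> \<zero>\<^bsub>R\<^esub> \<and> a \<otimes>\<^bsub>G\<^esub> b = g}),
     one = (\<lambda>g. if g = \<one>\<^bsub>G\<^esub> then \<one>\<^bsub>R\<^esub> else \<zero>\<^bsub>R\<^esub>),
     zero = (\<lambda>_. \<zero>\<^bsub>R\<^esub>),
     add = (\<lambda>p q g. p g \<oplus>\<^bsub>R\<^esub> q g),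
     smult = (\<lambda>r p g. r \<otimes>\<^bsub>R\<^esub> p g)\<rparr>"

definition basis_elem :: "('r, 'm) ring_scheme \<Rightarrow> 'g \<Rightarrow> 'g \<Rightarrow> 'r" where
  "basis_elem R g = (\<lambda>h. if h = g then \<one>\<^bsub>R\<^esub> else \<zero>\<^bsub>R\<^esub>)"

text \<open>
  The library locale \<^locale>\<open>ideal\<close> presupposes a unital ring.  Without a unit, closure under scalars is
  not automatic and is part of the notion of an ideal of an algebra.
\<close>

definition algebra_ideal ::
  "('r, 'm) ring_scheme \<Rightarrow> ('r, 'a) module \<Rightarrow> 'a set \<Rightarrow> bool" where
  "algebra_ideal R A I \<longleftrightarrow> submodule I R A \<and>
     (\<forall>x\<in>I. \<forall>a\<in>carrier A. a \<otimes>\<^bsub>A\<^esub> x \<in> I \<and> x \<otimes>\<^bsub>A\<^esub> a \<in> I)"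

definition generated_ideal ::
  "('r, 'm) ring_scheme \<Rightarrow> ('r, 'a) module \<Rightarrow> 'a set \<Rightarrow> 'a set" where
  "generated_ideal R A X = \<Inter> {I. algebra_ideal R A I \<and> X \<subseteq> I}"

definition quotient_algebra :: "('r, 'a) module \<Rightarrow> 'a set \<Rightarrow> ('r, 'a set) module" where
  "quotient_algebra A I =
     ring.extend (A Quot I) (module.fields (\<lambda>r X. \<Union>x\<in>X. I +>\<^bsub>A\<^esub> (r \<odot>\<^bsub>A\<^esub> x)))"

definition algebra_isomorphic ::
  "('r, 'm) ring_scheme \<Rightarrow> ('r, 'a) module \<Rightarrow> ('r, 'b) module \<Rightarrow> bool" where
  "algebra_isomorphic R A B \<longleftrightarrow> (\<exists>\<phi>. bij_betw \<phi> (carrier A) (carrier B) \<and>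
     (\<forall>x\<in>carrier A. \<forall>y\<in>carrier A. \<phi> (x \<oplus>\<^bsub>A\<^esub> y) = \<phi> x \<oplus>\<^bsub>B\<^esub> \<phi> y) \<and>
     (\<forall>x\<in>carrier A. \<forall>y\<in>carrier A. \<phi> (x \<otimes>\<^bsub>A\<^esub> y) = \<phi> x \<otimes>\<^bsub>B\<^esub> \<phi> y) \<and>
     (\<forall>r\<in>carrier R. \<forall>x\<in>carrier A. \<phi> (r \<odot>\<^bsub>A\<^esub> x) = r \<odot>\<^bsub>B\<^esub> \<phi> x))"


section \<open>Leavitt path algebras\<close>

definition free_semigroup :: "'x set \<Rightarrow> 'x list monoid" where
  "free_semigroup X = \<lparr>carrier = lists X - {[]}, mult = (@), one = []\<rparr>"

text \<open>The free associative, not necessarily unital, \<open>R\<close>-algebra on \<open>X\<close>.\<close>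

definition free_algebra :: "('r, 'm) ring_scheme \<Rightarrow> 'x set \<Rightarrow> ('r, 'x list \<Rightarrow> 'r) module" where
  "free_algebra R X = monoid_algebra R (free_semigroup X)"

text \<open>A directed graph is a \<^type>\<open>pre_digraph\<close> that is a \<^locale>\<open>wf_digraph\<close>; \<open>s\<close> is \<^const>\<open>tail\<close>, \<open>r\<close> is \<^const>\<open>head\<close>.\<close>

definition regular_verts :: "('v, 'e) pre_digraph \<Rightarrow> 'v set" where
  "regular_verts E = {v \<in> verts E. finite (out_arcs E v) \<and> out_arcs E v \<noteq> {}}"

datatype ('v, 'e) lpa_gen = Vertex 'v | Edge 'e | Ghost 'e

definition lpa_gens :: "('v, 'e) pre_digraph \<Rightarrow> ('v, 'e) lpa_gen set" where
  "lpa_gens E = Vertex ` verts E \<union> Edge ` arcs E \<union> Ghost ` arcs E"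

text \<open>An equation \<open>x = y\<close> among the defining relations is represented by the element \<open>x - y\<close>.\<close>

definition lpa_relators ::
  "('r, 'm) ring_scheme \<Rightarrow> ('v, 'e) pre_digraph \<Rightarrow> (('v, 'e) lpa_gen list \<Rightarrow> 'r) set" where
  "lpa_relators R E =
    (let F = free_algebra R (lpa_gens E);
         vx = (\<lambda>v. basis_elem R [Vertex v]);
         ed = (\<lambda>e. basis_elem R [Edge e]);
         gh = (\<lambda>e. basis_elem R [Ghost e])
     in \<comment> \<open>(V)\<close>
        {vx v \<otimes>\<^bsub>F\<^esub> vx w \<ominus>\<^bsub>F\<^esub> (if v = w then vx v else \<zero>\<^bsub>F\<^esub>) | v w. v \<in> verts E \<and> w \<in> verts E} \<union>
        \<comment> \<open>(E1)\<close>
        {vx (tail E e) \<otimes>\<^bsub>F\<^esub> ed e \<ominus>\<^bsub>F\<^esub> ed e | e. e \<in> arcs E} \<union>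
        {ed e \<otimes>\<^bsub>F\<^esub> vx (head E e) \<ominus>\<^bsub>F\<^esub> ed e | e. e \<in> arcs E} \<union>
        \<comment> \<open>(E2)\<close>
        {vx (head E e) \<otimes>\<^bsub>F\<^esub> gh e \<ominus>\<^bsub>F\<^esub> gh e | e. e \<in> arcs E} \<union>
        {gh e \<otimes>\<^bsub>F\<^esub> vx (tail E e) \<ominus>\<^bsub>F\<^esub> gh e | e. e \<in> arcs E} \<union>
        \<comment> \<open>(CK1)\<close>
        {gh e \<otimes>\<^bsub>F\<^esub> ed f \<ominus>\<^bsub>F\<^esub> (if e = f then vx (head E e) else \<zero>\<^bsub>F\<^esub>) | e f.
           e \<in> arcs E \<and> f \<in> arcs E} \<union>
        \<comment> \<open>(CK2)\<close>
        {vx v \<ominus>\<^bsub>F\<^esub> (\<Oplus>\<^bsub>F\<^esub>e\<in>out_arcs E v. ed e \<otimes>\<^bsub>F\<^esub> gh e) | v. v \<in> regular_verts E})"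

definition leavitt_path_algebra ::
  "('r, 'm) ring_scheme \<Rightarrow> ('v, 'e) pre_digraph \<Rightarrow> ('r, (('v, 'e) lpa_gen list \<Rightarrow> 'r) set) module" where
  "leavitt_path_algebra R E =
    (let F = free_algebra R (lpa_gens E)
     in quotient_algebra F (generated_ideal R F (lpa_relators R E)))"


section \<open>Tensor products of commutative algebras\<close>

text \<open>
  \<open>A \<otimes>\<^sub>K B\<close> is the quotient of the free \<open>K\<close>-module on \<open>A \<times> B\<close> by the bilinearity relations.  Taking that
  free module to be \<open>K[A \<times> B]\<close>, the monoid algebra of the multiplicative monoid \<open>A \<times> B\<close>, equips the
  quotient with the multiplication \<open>(a \<otimes> b)(c \<otimes> d) = ac \<otimes> bd\<close>.  Each kind of relator is stable under
  multiplication by basis elements, so the ideal generated by the relators coincides with the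
  submodule they span.
\<close>

definition tensor_relators ::
  "('k, 'm) ring_scheme \<Rightarrow> ('k, 'a) module \<Rightarrow> ('k, 'b) module \<Rightarrow> ('a \<times> 'b \<Rightarrow> 'k) set" where
  "tensor_relators K A B =
    (let F = monoid_algebra K (A \<times>\<times> B);
         \<delta> = (\<lambda>a b. basis_elem K (a, b))
     in {\<delta> (a \<oplus>\<^bsub>A\<^esub> a') b \<ominus>\<^bsub>F\<^esub> (\<delta> a b \<oplus>\<^bsub>F\<^esub> \<delta> a' b) | a a' b.
           a \<in> carrier A \<and> a' \<in> carrier A \<and> b \<in> carrier B} \<union>
        {\<delta> a (b \<oplus>\<^bsub>B\<^esub> b') \<ominus>\<^bsub>F\<^esub> (\<delta> a b \<oplus>\<^bsub>F\<^esub> \<delta> a b') | a b b'.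
           a \<in> carrier A \<and> b \<in> carrier B \<and> b' \<in> carrier B} \<union>
        {\<delta> (k \<odot>\<^bsub>A\<^esub> a) b \<ominus>\<^bsub>F\<^esub> (k \<odot>\<^bsub>F\<^esub> \<delta> a b) | k a b.
           k \<in> carrier K \<and> a \<in> carrier A \<and> b \<in> carrier B} \<union>
        {\<delta> a (k \<odot>\<^bsub>B\<^esub> b) \<ominus>\<^bsub>F\<^esub> (k \<odot>\<^bsub>F\<^esub> \<delta> a b) | k a b.
           k \<in> carrier K \<and> a \<in> carrier A \<and> b \<in> carrier B})"

definition tensor_ideal ::
  "('k, 'm) ring_scheme \<Rightarrow> ('k, 'a) module \<Rightarrow> ('k, 'b) module \<Rightarrow> ('a \<times> 'b \<Rightarrow> 'k) set" where
  "tensor_ideal K A B =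
     generated_ideal K (monoid_algebra K (A \<times>\<times> B)) (tensor_relators K A B)"

definition tensor ::
  "('k, 'm) ring_scheme \<Rightarrow> ('k, 'a) module \<Rightarrow> ('k, 'b) module \<Rightarrow> ('k, ('a \<times> 'b \<Rightarrow> 'k) set) module" where
  "tensor K A B = quotient_algebra (monoid_algebra K (A \<times>\<times> B)) (tensor_ideal K A B)"

definition pure_tensor ::
  "('k, 'm) ring_scheme \<Rightarrow> ('k, 'a) module \<Rightarrow> ('k, 'b) module \<Rightarrow> 'a \<Rightarrow> 'b \<Rightarrow> ('a \<times> 'b \<Rightarrow> 'k) set" where
  "pure_tensor K A B a b =
     tensor_ideal K A B +>\<^bsub>monoid_algebra K (A \<times>\<times> B)\<^esub> basis_elem K (a, b)"

text \<open>
  The linear map \<open>A \<otimes>\<^sub>K B \<rightarrow> P\<close> with \<open>a \<otimes> b \<mapsto> \<beta> a b\<close>.  It is evaluated on a representative of the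
  coset \<open>X\<close>; when \<open>\<beta>\<close> is \<open>K\<close>-bilinear, the value does not depend on which one.
\<close>

definition tensor_lift ::
  "('k, 'm) ring_scheme \<Rightarrow> ('k, 'p) module \<Rightarrow> ('a \<Rightarrow> 'b \<Rightarrow> 'p) \<Rightarrow> ('a \<times> 'b \<Rightarrow> 'k) set \<Rightarrow> 'p" where
  "tensor_lift K P \<beta> X =
    (let p = (SOME p. p \<in> X)
     in finsum P (\<lambda>(a, b). p (a, b) \<odot>\<^bsub>P\<^esub> \<beta> a b) {x. p x \<noteq> \<zero>\<^bsub>K\<^esub>})"

text \<open>\<open>f \<otimes> g\<close>, with values in \<open>A \<otimes>\<^sub>K B\<close>.\<close>

definition tensor_map ::
  "('k, 'm) ring_scheme \<Rightarrow> ('k, 'a) module \<Rightarrow> ('k, 'b) module \<Rightarrow>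
   ('c \<Rightarrow> 'a) \<Rightarrow> ('d \<Rightarrow> 'b) \<Rightarrow> ('c \<times> 'd \<Rightarrow> 'k) set \<Rightarrow> ('a \<times> 'b \<Rightarrow> 'k) set" where
  "tensor_map K A B f g =
     tensor_lift K (tensor K A B) (\<lambda>c d. pure_tensor K A B (f c) (g d))"

text \<open>The associator \<open>(A \<otimes> B) \<otimes> C \<rightarrow> A \<otimes> (B \<otimes> C)\<close>.\<close>

definition tensor_assoc ::
  "('k, 'm) ring_scheme \<Rightarrow> ('k, 'a) module \<Rightarrow> ('k, 'b) module \<Rightarrow> ('k, 'c) module \<Rightarrow>
   (('a \<times> 'b \<Rightarrow> 'k) set \<times> 'c \<Rightarrow> 'k) set \<Rightarrow> ('a \<times> ('b \<times> 'c \<Rightarrow> 'k) set \<Rightarrow> 'k) set" where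
  "tensor_assoc K A B C =
    (let BC = tensor K B C; T = tensor K A BC
     in tensor_lift K T (\<lambda>X c. tensor_lift K T
          (\<lambda>a b. pure_tensor K A BC a (pure_tensor K B C b c)) X))"


section \<open>Commutative Hopf algebras\<close>

text \<open>
  The library locale \<^locale>\<open>algebra\<close> describes commutative, associative and unital algebras.
\<close>

locale comm_hopf_algebra = algebra K H
  for K :: "('k, 'm) ring_scheme" and H :: "('k, 'h) module" +
  fixes comult :: "'h \<Rightarrow> ('h \<times> 'h \<Rightarrow> 'k) set"
    and counit :: "'h \<Rightarrow> 'k"
    and antipode :: "'h \<Rightarrow> 'h"
  assumes comult_ring_hom: "comult \<in> ring_hom H (tensor K H H)"
    and comult_smult: "\<lbrakk>k \<in> carrier K; x \<in> carrier H\<rbrakk> \<Longrightarrow>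
          comult (k \<odot>\<^bsub>H\<^esub> x) = k \<odot>\<^bsub>tensor K H H\<^esub> comult x"
    and counit_ring_hom: "counit \<in> ring_hom H K"
    and counit_smult: "\<lbrakk>k \<in> carrier K; x \<in> carrier H\<rbrakk> \<Longrightarrow>
          counit (k \<odot>\<^bsub>H\<^esub> x) = k \<otimes>\<^bsub>K\<^esub> counit x"
    and coassoc: "x \<in> carrier H \<Longrightarrow>
          tensor_assoc K H H H (tensor_map K (tensor K H H) H comult id (comult x)) =
          tensor_map K H (tensor K H H) id comult (comult x)"
    and counit_left: "x \<in> carrier H \<Longrightarrow>
          tensor_lift K H (\<lambda>a b. counit a \<odot>\<^bsub>H\<^esub> b) (comult x) = x"
    and counit_right: "x \<in> carrier H \<Longrightarrow>
          tensor_lift K H (\<lambda>a b. counit b \<odot>\<^bsub>H\<^esub> a) (comult x) = x"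
    and antipode_closed: "x \<in> carrier H \<Longrightarrow> antipode x \<in> carrier H"
    and antipode_add: "\<lbrakk>x \<in> carrier H; y \<in> carrier H\<rbrakk> \<Longrightarrow>
          antipode (x \<oplus>\<^bsub>H\<^esub> y) = antipode x \<oplus>\<^bsub>H\<^esub> antipode y"
    and antipode_smult: "\<lbrakk>k \<in> carrier K; x \<in> carrier H\<rbrakk> \<Longrightarrow>
          antipode (k \<odot>\<^bsub>H\<^esub> x) = k \<odot>\<^bsub>H\<^esub> antipode x"
    and antipode_left: "x \<in> carrier H \<Longrightarrow>
          tensor_lift K H (\<lambda>a b. antipode a \<otimes>\<^bsub>H\<^esub> b) (comult x) = counit x \<odot>\<^bsub>H\<^esub> \<one>\<^bsub>H\<^esub>"
    and antipode_right: "x \<in> carrier H \<Longrightarrow>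
          tensor_lift K H (\<lambda>a b. a \<otimes>\<^bsub>H\<^esub> antipode b) (comult x) = counit x \<odot>\<^bsub>H\<^esub> \<one>\<^bsub>H\<^esub>"

end

theory Submission
  imports Defs
begin

text \<open>
  A Hopf algebra \<open>H\<close> over \<open>K\<close> comes with ring homomorphisms in both directions: the unit \<open>K \<rightarrow> H\<close>
  and the counit \<open>H \<rightarrow> K\<close>, which for a group algebra is the augmentation.  Both implications are
  therefore instances of one statement: an isomorphism
  \<open>L_R(E1) \<cong> L_R(E2)\<close> can be pushed along every homomorphism \<open>f : R \<rightarrow> S\<close> of commutative rings.

  Abstractly this is the base change isomorphism \<open>L_S(E) \<cong> S \<otimes>\<^sub>R L_R(E)\<close>; here it is phrased in
  terms of universal properties.  The defining relations of a Leavitt path algebra contain no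
  scalars, so whether elements of an \<open>S\<close>-algebra satisfy them does not change when it is viewed as an
  \<open>R\<close>-algebra through \<open>f\<close>.
  The universal property over \<open>R\<close> therefore gives canonical maps \<open>\<theta>\<^sub>i : L_R(E\<^sub>i) \<rightarrow> L_S(E\<^sub>i)\<close> that
  fix the generators.  Given a homomorphism \<open>\<phi> : L_R(E1) \<rightarrow> L_R(E2)\<close>, the images of the generators
  under \<open>\<theta>\<^sub>2 \<circ> \<phi>\<close> satisfy the relations of \<open>E1\<close> in \<open>L_S(E2)\<close>, so the universal property over
  \<open>S\<close> gives \<open>\<Phi> : L_S(E1) \<rightarrow> L_S(E2)\<close> with \<open>\<Phi> \<circ> \<theta>\<^sub>1 = \<theta>\<^sub>2 \<circ> \<phi>\<close> (lemma \<open>lpa_base_change_hom\<close>).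
  If \<open>\<phi>\<close> and \<open>\<psi>\<close> are mutually inverse, the maps \<open>\<Phi>\<close> and \<open>\<Psi>\<close> obtained from them compose to
  endomorphisms that fix all generators and hence are identities
  (theorem \<open>leavitt_path_algebra_isomorphic_base_change\<close>).

  The bulk of the work is the universal property itself (\<open>lpa_lift\<close> and \<open>lpa_hom_eq\<close>) for the
  concrete construction as a quotient of an algebra of finitely supported functions on words.
\<close>


section \<open>Non-unital algebras and their homomorphisms\<close>

locale nonunital_algebra = Module.module R A
  for R :: "('r, 'm) ring_scheme" (structure) and A :: "('r, 'a) module" (structure) +
  assumes mult_closed [simp, intro]:
      "\<lbrakk>x \<in> carrier A; y \<in> carrier A\<rbrakk> \<Longrightarrow> x \<otimes>\<^bsub>A\<^esub> y \<in> carrier A"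
    and mult_assoc:
      "\<lbrakk>x \<in> carrier A; y \<in> carrier A; z \<in> carrier A\<rbrakk> \<Longrightarrow>
       (x \<otimes>\<^bsub>A\<^esub> y) \<otimes>\<^bsub>A\<^esub> z = x \<otimes>\<^bsub>A\<^esub> (y \<otimes>\<^bsub>A\<^esub> z)"
    and mult_l_distr:
      "\<lbrakk>x \<in> carrier A; y \<in> carrier A; z \<in> carrier A\<rbrakk> \<Longrightarrow>
       (x \<oplus>\<^bsub>A\<^esub> y) \<otimes>\<^bsub>A\<^esub> z = x \<otimes>\<^bsub>A\<^esub> z \<oplus>\<^bsub>A\<^esub> y \<otimes>\<^bsub>A\<^esub> z"
    and mult_r_distr:
      "\<lbrakk>x \<in> carrier A; y \<in> carrier A; z \<in> carrier A\<rbrakk> \<Longrightarrow>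
       z \<otimes>\<^bsub>A\<^esub> (x \<oplus>\<^bsub>A\<^esub> y) = z \<otimes>\<^bsub>A\<^esub> x \<oplus>\<^bsub>A\<^esub> z \<otimes>\<^bsub>A\<^esub> y"
    and smult_mult_left:
      "\<lbrakk>r \<in> carrier R; x \<in> carrier A; y \<in> carrier A\<rbrakk> \<Longrightarrow>
       (r \<odot>\<^bsub>A\<^esub> x) \<otimes>\<^bsub>A\<^esub> y = r \<odot>\<^bsub>A\<^esub> (x \<otimes>\<^bsub>A\<^esub> y)"
    and smult_mult_right:
      "\<lbrakk>r \<in> carrier R; x \<in> carrier A; y \<in> carrier A\<rbrakk> \<Longrightarrow>
       x \<otimes>\<^bsub>A\<^esub> (r \<odot>\<^bsub>A\<^esub> y) = r \<odot>\<^bsub>A\<^esub> (x \<otimes>\<^bsub>A\<^esub> y)"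
begin

lemma mult_zero_left [simp]: "x \<in> carrier A \<Longrightarrow> \<zero>\<^bsub>A\<^esub> \<otimes>\<^bsub>A\<^esub> x = \<zero>\<^bsub>A\<^esub>"
  using smult_mult_left[of "\<zero>" "\<zero>\<^bsub>A\<^esub>" x] by simp

lemma mult_zero_right [simp]: "x \<in> carrier A \<Longrightarrow> x \<otimes>\<^bsub>A\<^esub> \<zero>\<^bsub>A\<^esub> = \<zero>\<^bsub>A\<^esub>"
  using smult_mult_right[of "\<zero>" x "\<zero>\<^bsub>A\<^esub>"] by simp

end

definition algebra_hom ::
  "('r, 'm) ring_scheme \<Rightarrow> ('r, 'a) module \<Rightarrow> ('r, 'b) module \<Rightarrow> ('a \<Rightarrow> 'b) set" where
  "algebra_hom R A B = {h. (\<forall>x\<in>carrier A. h x \<in> carrier B) \<and>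
     (\<forall>x\<in>carrier A. \<forall>y\<in>carrier A. h (x \<oplus>\<^bsub>A\<^esub> y) = h x \<oplus>\<^bsub>B\<^esub> h y) \<and>
     (\<forall>x\<in>carrier A. \<forall>y\<in>carrier A. h (x \<otimes>\<^bsub>A\<^esub> y) = h x \<otimes>\<^bsub>B\<^esub> h y) \<and>
     (\<forall>r\<in>carrier R. \<forall>x\<in>carrier A. h (r \<odot>\<^bsub>A\<^esub> x) = r \<odot>\<^bsub>B\<^esub> h x)}"

lemma algebra_homI:
  assumes "\<And>x. x \<in> carrier A \<Longrightarrow> h x \<in> carrier B"
    and "\<And>x y. \<lbrakk>x \<in> carrier A; y \<in> carrier A\<rbrakk> \<Longrightarrow> h (x \<oplus>\<^bsub>A\<^esub> y) = h x \<oplus>\<^bsub>B\<^esub> h y"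
    and "\<And>x y. \<lbrakk>x \<in> carrier A; y \<in> carrier A\<rbrakk> \<Longrightarrow> h (x \<otimes>\<^bsub>A\<^esub> y) = h x \<otimes>\<^bsub>B\<^esub> h y"
    and "\<And>r x. \<lbrakk>r \<in> carrier R; x \<in> carrier A\<rbrakk> \<Longrightarrow> h (r \<odot>\<^bsub>A\<^esub> x) = r \<odot>\<^bsub>B\<^esub> h x"
  shows "h \<in> algebra_hom R A B"
  using assms by (auto simp: algebra_hom_def)

lemma algebra_homD:
  assumes "h \<in> algebra_hom R A B"
  shows "\<And>x. x \<in> carrier A \<Longrightarrow> h x \<in> carrier B"
    and "\<And>x y. \<lbrakk>x \<in> carrier A; y \<in> carrier A\<rbrakk> \<Longrightarrow> h (x \<oplus>\<^bsub>A\<^esub> y) = h x \<oplus>\<^bsub>B\<^esub> h y"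
    and "\<And>x y. \<lbrakk>x \<in> carrier A; y \<in> carrier A\<rbrakk> \<Longrightarrow> h (x \<otimes>\<^bsub>A\<^esub> y) = h x \<otimes>\<^bsub>B\<^esub> h y"
    and "\<And>r x. \<lbrakk>r \<in> carrier R; x \<in> carrier A\<rbrakk> \<Longrightarrow> h (r \<odot>\<^bsub>A\<^esub> x) = r \<odot>\<^bsub>B\<^esub> h x"
  using assms by (auto simp: algebra_hom_def)

lemma algebra_hom_comp:
  assumes "h \<in> algebra_hom R A B" "k \<in> algebra_hom R B C"
  shows "(\<lambda>x. k (h x)) \<in> algebra_hom R A C"
  using assms by (auto simp: algebra_hom_def)

lemma algebra_hom_id: "(\<lambda>x. x) \<in> algebra_hom R A A"
  by (simp add: algebra_hom_def)

locale algebra_homomorphism =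
  A: nonunital_algebra R A + B: nonunital_algebra R B
  for R :: "('r, 'm) ring_scheme" (structure) and A :: "('r, 'a) module" and B :: "('r, 'b) module" +
  fixes h
  assumes hom: "h \<in> algebra_hom R A B"
begin

lemmas hom_simps [simp] = algebra_homD[OF hom]

sublocale abelian_group_hom A B h
  by (intro abelian_group_homI A.abelian_group_axioms B.abelian_group_axioms)
    (auto intro!: group_hom.intro A.a_group B.a_group simp: group_hom_axioms_def hom_def)

lemma hom_minus:
  assumes "x \<in> carrier A" "y \<in> carrier A"
  shows "h (x \<ominus>\<^bsub>A\<^esub> y) = h x \<ominus>\<^bsub>B\<^esub> h y"
  using assms by (simp add: a_minus_def)

lemma hom_minus_eq_zero_iff:
  assumes "x \<in> carrier A" "y \<in> carrier A"
  shows "h (x \<ominus>\<^bsub>A\<^esub> y) = \<zero>\<^bsub>B\<^esub> \<longleftrightarrow> h x = h y"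
proof
  assume "h (x \<ominus>\<^bsub>A\<^esub> y) = \<zero>\<^bsub>B\<^esub>"
  then have "h x \<ominus>\<^bsub>B\<^esub> h y \<oplus>\<^bsub>B\<^esub> h y = h y"
    using assms by (simp add: hom_minus)
  then show "h x = h y"
    using assms by (simp add: a_minus_def B.a_assoc B.l_neg)
qed (use assms in \<open>simp add: hom_minus a_minus_def B.r_neg\<close>)

lemma hom_finsum:
  assumes "f \<in> I \<rightarrow> carrier A"
  shows "h (\<Oplus>\<^bsub>A\<^esub>i\<in>I. f i) = (\<Oplus>\<^bsub>B\<^esub>i\<in>I. h (f i))"
  using assms by (induct I rule: infinite_finite_induct) (auto simp: Pi_def)

lemma kernel_is_ideal: "algebra_ideal R A {x \<in> carrier A. h x = \<zero>\<^bsub>B\<^esub>}"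
  unfolding algebra_ideal_def by (auto intro!: A.submoduleI)

end

lemma algebra_isomorphicE:
  assumes "algebra_isomorphic R A B" "nonunital_algebra R A"
  obtains \<phi> \<psi> where "\<phi> \<in> algebra_hom R A B" "\<psi> \<in> algebra_hom R B A"
    "\<And>x. x \<in> carrier A \<Longrightarrow> \<psi> (\<phi> x) = x" "\<And>y. y \<in> carrier B \<Longrightarrow> \<phi> (\<psi> y) = y"
proof -
  interpret nonunital_algebra R A by fact
  from assms(1) obtain \<phi> where bij: "bij_betw \<phi> (carrier A) (carrier B)"
    and add: "\<And>x y. \<lbrakk>x \<in> carrier A; y \<in> carrier A\<rbrakk> \<Longrightarrow> \<phi> (x \<oplus>\<^bsub>A\<^esub> y) = \<phi> x \<oplus>\<^bsub>B\<^esub> \<phi> y"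
    and mult: "\<And>x y. \<lbrakk>x \<in> carrier A; y \<in> carrier A\<rbrakk> \<Longrightarrow> \<phi> (x \<otimes>\<^bsub>A\<^esub> y) = \<phi> x \<otimes>\<^bsub>B\<^esub> \<phi> y"
    and smult: "\<And>r x. \<lbrakk>r \<in> carrier R; x \<in> carrier A\<rbrakk> \<Longrightarrow> \<phi> (r \<odot>\<^bsub>A\<^esub> x) = r \<odot>\<^bsub>B\<^esub> \<phi> x"
    unfolding algebra_isomorphic_def by blast
  define \<psi> where "\<psi> = the_inv_into (carrier A) \<phi>"
  have inj: "inj_on \<phi> (carrier A)" and im: "\<phi> ` carrier A = carrier B"
    using bij by (auto simp: bij_betw_def)
  have \<psi>\<phi>: "\<psi> (\<phi> x) = x" if "x \<in> carrier A" for x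
    using that inj by (simp add: \<psi>_def the_inv_into_f_f)
  have \<phi>\<psi>: "\<phi> (\<psi> y) = y" if "y \<in> carrier B" for y
    using that inj im by (simp add: \<psi>_def f_the_inv_into_f)
  have \<psi>_closed: "\<psi> y \<in> carrier A" if "y \<in> carrier B" for y
    using that \<psi>\<phi> unfolding im[symmetric] by auto
  have "\<phi> \<in> algebra_hom R A B"
    using add mult smult im by (intro algebra_homI) auto
  moreover have "\<psi> \<in> algebra_hom R B A"
  proof (intro algebra_homI)
    fix x y assume xy: "x \<in> carrier B" "y \<in> carrier B"
    have "\<psi> (\<phi> (\<psi> x) \<oplus>\<^bsub>B\<^esub> \<phi> (\<psi> y)) = \<psi> x \<oplus>\<^bsub>A\<^esub> \<psi> y"
      using xy by (simp add: \<psi>\<phi> \<psi>_closed flip: add)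
    then show "\<psi> (x \<oplus>\<^bsub>B\<^esub> y) = \<psi> x \<oplus>\<^bsub>A\<^esub> \<psi> y"
      using xy by (simp add: \<phi>\<psi>)
    have "\<psi> (\<phi> (\<psi> x) \<otimes>\<^bsub>B\<^esub> \<phi> (\<psi> y)) = \<psi> x \<otimes>\<^bsub>A\<^esub> \<psi> y"
      using xy by (simp add: \<psi>\<phi> \<psi>_closed flip: mult)
    then show "\<psi> (x \<otimes>\<^bsub>B\<^esub> y) = \<psi> x \<otimes>\<^bsub>A\<^esub> \<psi> y"
      using xy by (simp add: \<phi>\<psi>)
  next
    fix r x assume rx: "r \<in> carrier R" "x \<in> carrier B"
    have "\<psi> (r \<odot>\<^bsub>B\<^esub> \<phi> (\<psi> x)) = r \<odot>\<^bsub>A\<^esub> \<psi> x"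
      using rx by (simp add: \<psi>\<phi> \<psi>_closed flip: smult)
    then show "\<psi> (r \<odot>\<^bsub>B\<^esub> x) = r \<odot>\<^bsub>A\<^esub> \<psi> x"
      using rx by (simp add: \<phi>\<psi>)
  qed (rule \<psi>_closed)
  ultimately show thesis
    using that \<psi>\<phi> \<phi>\<psi> by blast
qed

lemma algebra_isomorphicI:
  assumes "\<phi> \<in> algebra_hom R A B" "\<psi> \<in> algebra_hom R B A"
    and "\<And>x. x \<in> carrier A \<Longrightarrow> \<psi> (\<phi> x) = x" "\<And>y. y \<in> carrier B \<Longrightarrow> \<phi> (\<psi> y) = y"
  shows "algebra_isomorphic R A B"
  unfolding algebra_isomorphic_def
  using assms(3,4) algebra_homD[OF assms(1)] algebra_homD[OF assms(2)]
  by (intro exI[of _ \<phi>] conjI bij_betw_byWitness[of _ \<psi>]) auto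


section \<open>Quotients by ideals\<close>

lemma quotient_algebra_simps:
  "carrier (quotient_algebra A I) = a_rcosets\<^bsub>A\<^esub> I"
  "mult (quotient_algebra A I) = rcoset_mult A I"
  "zero (quotient_algebra A I) = I"
  "add (quotient_algebra A I) = set_add A"
  "smult (quotient_algebra A I) = (\<lambda>r X. \<Union>x\<in>X. I +>\<^bsub>A\<^esub> (r \<odot>\<^bsub>A\<^esub> x))"
  by (simp_all add: quotient_algebra_def ring.defs module.defs FactRing_def)

text \<open>
  Closure of the ideal under multiplication from both sides and under scalars makes the product and
  the scalar multiples of cosets independent of representatives, also in the absence of a unit.
\<close>

locale algebra_with_ideal = nonunital_algebra R A
  for R :: "('r, 'm) ring_scheme" (structure) and A :: "('r, 'a) module" (structure) +
  fixes I
  assumes ideal: "algebra_ideal R A I"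
begin

abbreviation proj where "proj x \<equiv> I +>\<^bsub>A\<^esub> x"

lemma sub: "submodule I R A"
  using ideal by (simp add: algebra_ideal_def)

lemma ideal_mult:
  "\<lbrakk>x \<in> I; a \<in> carrier A\<rbrakk> \<Longrightarrow> a \<otimes>\<^bsub>A\<^esub> x \<in> I"
  "\<lbrakk>x \<in> I; a \<in> carrier A\<rbrakk> \<Longrightarrow> x \<otimes>\<^bsub>A\<^esub> a \<in> I"
  using ideal by (auto simp: algebra_ideal_def)

sublocale abelian_subgroup I A
  by (intro abelian_subgroupI3 additive_subgroup.intro)
    (use sub abelian_group_axioms in \<open>auto simp: submodule_def\<close>)

lemma proj_eq_iff:
  assumes "x \<in> carrier A" "y \<in> carrier A"
  shows "proj x = proj y \<longleftrightarrow> x \<ominus>\<^bsub>A\<^esub> y \<in> I"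
proof
  assume "proj x = proj y"
  then have "x \<in> proj y"
    using a_rcos_self[OF assms(1)] by simp
  then show "x \<ominus>\<^bsub>A\<^esub> y \<in> I"
    using assms a_rcos_module by (simp add: a_minus_def)
next
  assume "x \<ominus>\<^bsub>A\<^esub> y \<in> I"
  then have "x \<in> proj y"
    using assms a_rcos_module by (simp add: a_minus_def)
  then show "proj x = proj y"
    using a_repr_independence'[OF _ assms(2)] by simp
qed

lemma proj_add_ideal:
  assumes "i \<in> I" "x \<in> carrier A"
  shows "proj (i \<oplus>\<^bsub>A\<^esub> x) = proj x"
  using assms by (subst proj_eq_iff) (auto simp: a_minus_def a_assoc r_neg)

lemma coset_elim:
  assumes "y \<in> proj x"
  obtains i where "i \<in> I" "y = i \<oplus>\<^bsub>A\<^esub> x"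
  using assms by (auto simp: a_r_coset_def r_coset_def)

lemma proj_mult:
  assumes x: "x \<in> carrier A" and y: "y \<in> carrier A"
  shows "rcoset_mult A I (proj x) (proj y) = proj (x \<otimes>\<^bsub>A\<^esub> y)"
proof -
  have rep: "proj (x' \<otimes>\<^bsub>A\<^esub> y') = proj (x \<otimes>\<^bsub>A\<^esub> y)"
    if x': "x' \<in> proj x" and y': "y' \<in> proj y" for x' y'
  proof -
    obtain i j where i: "i \<in> I" "x' = i \<oplus>\<^bsub>A\<^esub> x" and j: "j \<in> I" "y' = j \<oplus>\<^bsub>A\<^esub> y"
      using coset_elim x' y' by metis
    have "x' \<otimes>\<^bsub>A\<^esub> y' = (i \<otimes>\<^bsub>A\<^esub> y' \<oplus>\<^bsub>A\<^esub> x \<otimes>\<^bsub>A\<^esub> j) \<oplus>\<^bsub>A\<^esub> x \<otimes>\<^bsub>A\<^esub> y"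
      using i j x y by (simp add: mult_l_distr mult_r_distr a_ac)
    then show ?thesis
      using i j x y by (simp add: proj_add_ideal ideal_mult)
  qed
  have "(\<Union>b\<in>proj y. proj (a \<otimes>\<^bsub>A\<^esub> b)) = proj (x \<otimes>\<^bsub>A\<^esub> y)" if a: "a \<in> proj x" for a
    using rep[OF a] a_rcos_self[OF y] by blast
  then show ?thesis
    unfolding rcoset_mult_def using a_rcos_self[OF x] by blast
qed

lemma proj_smult:
  assumes r: "r \<in> carrier R" and x: "x \<in> carrier A"
  shows "(\<Union>y\<in>proj x. proj (r \<odot>\<^bsub>A\<^esub> y)) = proj (r \<odot>\<^bsub>A\<^esub> x)"
proof -
  have "proj (r \<odot>\<^bsub>A\<^esub> y) = proj (r \<odot>\<^bsub>A\<^esub> x)" if y: "y \<in> proj x" for y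
  proof -
    obtain i where i: "i \<in> I" "y = i \<oplus>\<^bsub>A\<^esub> x"
      by (rule coset_elim[OF y])
    moreover have "r \<odot>\<^bsub>A\<^esub> i \<in> I"
      using submodule.smult_closed[OF sub r] i by simp
    ultimately show ?thesis
      using r x by (simp add: smult_r_distr proj_add_ideal)
  qed
  then show ?thesis
    using a_rcos_self[OF x] by blast
qed

lemma quotient_carrierE:
  assumes "X \<in> carrier (quotient_algebra A I)"
  obtains x where "x \<in> carrier A" "X = proj x"
  using assms by (auto simp: quotient_algebra_simps A_RCOSETS_def')

lemma proj_hom: "proj \<in> algebra_hom R A (quotient_algebra A I)"
  by (intro algebra_homI)
    (simp_all add: quotient_algebra_simps proj_mult proj_smult a_rcos_sum a_rcosetsI a_subset)

lemma proj_eq_zero_iff: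
  assumes "x \<in> carrier A"
  shows "proj x = \<zero>\<^bsub>quotient_algebra A I\<^esub> \<longleftrightarrow> x \<in> I"
  using assms a_coset_join2 a_rcos_self a_subgroup by (auto simp: quotient_algebra_simps)

lemma quotient_is_algebra: "nonunital_algebra R (quotient_algebra A I)"
proof -
  let ?Q = "quotient_algebra A I"
  note [simp] = algebra_homD(2-4)[OF proj_hom, symmetric]
  have zero: "\<zero>\<^bsub>?Q\<^esub> = proj \<zero>\<^bsub>A\<^esub>"
    using proj_eq_zero_iff[of "\<zero>\<^bsub>A\<^esub>"] by simp
  have closed [simp]: "proj x \<in> carrier ?Q" if "x \<in> carrier A" for x
    using that algebra_homD(1)[OF proj_hom] by simp
  have "abelian_group ?Q"
  proof (rule abelian_groupI)
    fix X assume "X \<in> carrier ?Q"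
    then obtain x where x: "x \<in> carrier A" "X = proj x"
      by (rule quotient_carrierE)
    then have "proj (\<ominus>\<^bsub>A\<^esub> x) \<oplus>\<^bsub>?Q\<^esub> X = \<zero>\<^bsub>?Q\<^esub>"
      by (simp add: zero l_neg)
    then show "\<exists>Y\<in>carrier ?Q. Y \<oplus>\<^bsub>?Q\<^esub> X = \<zero>\<^bsub>?Q\<^esub>"
      using x by (intro bexI[of _ "proj (\<ominus>\<^bsub>A\<^esub> x)"]) auto
  qed (auto elim!: quotient_carrierE simp: zero a_ac)
  then show ?thesis
    unfolding nonunital_algebra_def nonunital_algebra_axioms_def
    by (intro conjI moduleI is_cring allI impI)
      (auto elim!: quotient_carrierE simp: smult_l_distr smult_r_distr smult_assoc1
        mult_assoc mult_l_distr mult_r_distr smult_mult_left smult_mult_right)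
qed

text \<open>
  The image of a coset is the value at a chosen representative.  Two representatives differ by an
  element of the ideal, where the homomorphism vanishes.
\<close>

lemma quotient_lift:
  assumes B: "nonunital_algebra R B" and h: "h \<in> algebra_hom R A B"
    and kill: "\<And>x. x \<in> I \<Longrightarrow> h x = \<zero>\<^bsub>B\<^esub>"
  obtains h' where "h' \<in> algebra_hom R (quotient_algebra A I) B"
    "\<And>x. x \<in> carrier A \<Longrightarrow> h' (proj x) = h x"
proof -
  interpret h: algebra_homomorphism R A B h
    using B h nonunital_algebra_axioms
    by (simp add: algebra_homomorphism_def algebra_homomorphism_axioms_def)
  define h' where "h' = (\<lambda>X. h (SOME x. x \<in> carrier A \<and> proj x = X))"
  have h': "h' (proj x) = h x" if x: "x \<in> carrier A" for x
  proof -
    define y where "y = (SOME y. y \<in> carrier A \<and> proj y = proj x)"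
    have y: "y \<in> carrier A \<and> proj y = proj x"
      unfolding y_def by (rule someI[of _ x]) (use x in simp)
    then have "h (y \<ominus>\<^bsub>A\<^esub> x) = \<zero>\<^bsub>B\<^esub>"
      using x proj_eq_iff by (intro kill) auto
    then show ?thesis
      using x y h.hom_minus_eq_zero_iff by (simp add: h'_def y_def)
  qed
  have "h' \<in> algebra_hom R (quotient_algebra A I) B"
    by (intro algebra_homI)
      (auto elim!: quotient_carrierE simp: h' algebra_homD(2-4)[OF proj_hom, symmetric])
  then show thesis
    using that h' by blast
qed

end

lemma (in nonunital_algebra) generated_ideal_is_ideal:
  assumes "X \<subseteq> carrier A"
  shows "algebra_ideal R A (generated_ideal R A X)"
proof -
  have top: "algebra_ideal R A (carrier A)"
    using carrier_is_submodule by (simp add: algebra_ideal_def)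
  have I: "submodule I R A" if "algebra_ideal R A I" for I
    using that by (simp add: algebra_ideal_def)
  have zero: "\<zero>\<^bsub>A\<^esub> \<in> I" if "algebra_ideal R A I" for I
    using subgroup.one_closed[OF submodule.axioms(1)[OF I[OF that]]] by simp
  show ?thesis
    unfolding algebra_ideal_def
  proof (intro conjI submoduleI)
    show "generated_ideal R A X \<subseteq> carrier A"
      using top assms by (auto simp: generated_ideal_def)
    show "\<zero>\<^bsub>A\<^esub> \<in> generated_ideal R A X"
      using zero by (simp add: generated_ideal_def)
  qed (use submoduleE[OF I] in \<open>simp_all add: generated_ideal_def algebra_ideal_def\<close>)
qed

lemma generated_ideal_superset: "X \<subseteq> generated_ideal R A X"
  by (auto simp: generated_ideal_def)

lemma generated_ideal_least:
  "\<lbrakk>algebra_ideal R A I; X \<subseteq> I\<rbrakk> \<Longrightarrow> generated_ideal R A X \<subseteq> I"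
  by (auto simp: generated_ideal_def)


section \<open>Semigroup algebras\<close>

text \<open>
  Both the free algebra (words under concatenation) and the group algebra are instances, so that
  one proof of associativity and of the universal property serves for both.
\<close>

locale semigroup_algebra = cring R
  for R :: "('r, 'm) ring_scheme" (structure) and G :: "('g, 'n) monoid_scheme" +
  assumes op_closed [simp]:
      "\<lbrakk>a \<in> carrier G; b \<in> carrier G\<rbrakk> \<Longrightarrow> a \<otimes>\<^bsub>G\<^esub> b \<in> carrier G"
    and op_assoc:
      "\<lbrakk>a \<in> carrier G; b \<in> carrier G; c \<in> carrier G\<rbrakk> \<Longrightarrow>
       (a \<otimes>\<^bsub>G\<^esub> b) \<otimes>\<^bsub>G\<^esub> c = a \<otimes>\<^bsub>G\<^esub> (b \<otimes>\<^bsub>G\<^esub> c)"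
begin

abbreviation F where "F \<equiv> monoid_algebra R G"

abbreviation support :: "('g \<Rightarrow> 'r) \<Rightarrow> 'g set" where "support p \<equiv> {g. p g \<noteq> \<zero>}"

lemma F_simps:
  "(p \<oplus>\<^bsub>F\<^esub> q) = (\<lambda>g. p g \<oplus> q g)"
  "\<zero>\<^bsub>F\<^esub> = (\<lambda>_. \<zero>)"
  "r \<odot>\<^bsub>F\<^esub> p = (\<lambda>g. r \<otimes> p g)"
  "\<one>\<^bsub>F\<^esub> = basis_elem R \<one>\<^bsub>G\<^esub>"
  by (simp_all add: monoid_algebra_def basis_elem_def)

lemma F_apply:
  "(p \<oplus>\<^bsub>F\<^esub> q) g = p g \<oplus> q g" "\<zero>\<^bsub>F\<^esub> g = \<zero>" "(r \<odot>\<^bsub>F\<^esub> p) g = r \<otimes> p g"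
  "basis_elem R a g = (if g = a then \<one> else \<zero>)"
  by (simp_all add: F_simps basis_elem_def)

lemma carrier_F_iff:
  "p \<in> carrier F \<longleftrightarrow>
     (\<forall>g. p g \<in> carrier R) \<and> support p \<subseteq> carrier G \<and> finite (support p)"
  by (auto simp: monoid_algebra_def)

lemma coeff_closed [simp]: "p \<in> carrier F \<Longrightarrow> p g \<in> carrier R"
  by (simp add: carrier_F_iff)

lemma basis_closed [simp]: "g \<in> carrier G \<Longrightarrow> basis_elem R g \<in> carrier F"
  by (auto simp: carrier_F_iff basis_elem_def)

lemma F_add_closed [simp]:
  assumes "p \<in> carrier F" "q \<in> carrier F"
  shows "p \<oplus>\<^bsub>F\<^esub> q \<in> carrier F"
proof -
  have "support (p \<oplus>\<^bsub>F\<^esub> q) \<subseteq> support p \<union> support q"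
    by (auto simp: F_simps)
  then show ?thesis
    using assms by (auto simp: carrier_F_iff F_simps intro: finite_subset)
qed

lemma F_smult_closed [simp]:
  assumes "r \<in> carrier R" "p \<in> carrier F"
  shows "r \<odot>\<^bsub>F\<^esub> p \<in> carrier F"
proof -
  have "support (r \<odot>\<^bsub>F\<^esub> p) \<subseteq> support p"
    using assms by (auto simp: F_simps)
  then show ?thesis
    using assms by (auto simp: carrier_F_iff F_simps intro: finite_subset)
qed

lemma F_zero_closed [simp]: "\<zero>\<^bsub>F\<^esub> \<in> carrier F"
  by (simp add: carrier_F_iff F_simps)

lemma module_F: "Module.module R F"
proof (intro moduleI is_cring abelian_groupI)
  fix p assume p: "p \<in> carrier F"
  then have "(\<ominus> \<one>) \<odot>\<^bsub>F\<^esub> p \<oplus>\<^bsub>F\<^esub> p = \<zero>\<^bsub>F\<^esub>"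
    by (auto simp: F_simps l_minus l_neg)
  then show "\<exists>q\<in>carrier F. q \<oplus>\<^bsub>F\<^esub> p = \<zero>\<^bsub>F\<^esub>"
    using p by (intro bexI[of _ "(\<ominus> \<one>) \<odot>\<^bsub>F\<^esub> p"]) auto
qed (simp_all, auto simp: F_simps a_ac l_distr r_distr m_assoc)

sublocale F: Module.module R F
  by (rule module_F)

text \<open>
  The convolution product sums over a set that depends on both factors and on the argument.
  Summing over any rectangle that contains the supports instead makes identities between different
  products comparable term by term.
\<close>

lemma convolution_eq:
  assumes p: "p \<in> carrier F" and q: "q \<in> carrier F"
    and fin: "finite A" "finite B" and sub: "support p \<subseteq> A" "support q \<subseteq> B"
  shows "(p \<otimes>\<^bsub>F\<^esub> q) g =
    (\<Oplus>x\<in>A \<times> B. if fst x \<otimes>\<^bsub>G\<^esub> snd x = g then p (fst x) \<otimes> q (snd x) else \<zero>)"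
proof -
  have "(p \<otimes>\<^bsub>F\<^esub> q) g = finsum R (\<lambda>(a, b). p a \<otimes> q b)
      {(a, b). p a \<noteq> \<zero> \<and> q b \<noteq> \<zero> \<and> a \<otimes>\<^bsub>G\<^esub> b = g}"
    by (simp add: monoid_algebra_def)
  also have "\<dots> = (\<Oplus>x\<in>A \<times> B. if fst x \<otimes>\<^bsub>G\<^esub> snd x = g then p (fst x) \<otimes> q (snd x) else \<zero>)"
    using p q fin sub by (intro add.finprod_mono_neutral_cong_left) auto
  finally show ?thesis .
qed

lemma F_mult_closed [simp]:
  assumes p: "p \<in> carrier F" and q: "q \<in> carrier F"
  shows "p \<otimes>\<^bsub>F\<^esub> q \<in> carrier F"
proof -
  let ?AB = "support p \<times> support q"
  have fin: "finite (support p)" "finite (support q)"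
    and sub: "support p \<subseteq> carrier G" "support q \<subseteq> carrier G"
    using p q by (auto simp: carrier_F_iff)
  note eq = convolution_eq[OF p q fin subset_refl subset_refl]
  have "(p \<otimes>\<^bsub>F\<^esub> q) g = \<zero>" if "g \<notin> (\<lambda>x. fst x \<otimes>\<^bsub>G\<^esub> snd x) ` ?AB" for g
    unfolding eq by (rule add.finprod_one_eqI) (use that in auto)
  then have "support (p \<otimes>\<^bsub>F\<^esub> q) \<subseteq> (\<lambda>x. fst x \<otimes>\<^bsub>G\<^esub> snd x) ` ?AB"
    by blast
  moreover have "(p \<otimes>\<^bsub>F\<^esub> q) g \<in> carrier R" for g
    unfolding eq using p q by (intro finsum_closed) auto
  moreover have "(\<lambda>x. fst x \<otimes>\<^bsub>G\<^esub> snd x) ` ?AB \<subseteq> carrier G"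
    using sub by (auto simp: subset_iff)
  ultimately show ?thesis
    unfolding carrier_F_iff using fin by (meson finite_SigmaI finite_imageI finite_subset subset_trans)
qed

lemma F_l_distr:
  assumes p: "p \<in> carrier F" and p': "p' \<in> carrier F" and q: "q \<in> carrier F"
  shows "(p \<oplus>\<^bsub>F\<^esub> p') \<otimes>\<^bsub>F\<^esub> q = p \<otimes>\<^bsub>F\<^esub> q \<oplus>\<^bsub>F\<^esub> p' \<otimes>\<^bsub>F\<^esub> q"
proof
  fix g
  let ?A = "support p \<union> support p'" and ?B = "support q"
  let ?f = "\<lambda>p x. if fst x \<otimes>\<^bsub>G\<^esub> snd x = g then p (fst x) \<otimes> q (snd x) else \<zero>"
  have fin: "finite ?A" "finite ?B"
    using p p' q by (auto simp: carrier_F_iff)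
  have "((p \<oplus>\<^bsub>F\<^esub> p') \<otimes>\<^bsub>F\<^esub> q) g = (\<Oplus>x\<in>?A \<times> ?B. ?f (p \<oplus>\<^bsub>F\<^esub> p') x)"
    using p p' q fin by (intro convolution_eq) (auto simp: F_apply)
  also have "\<dots> = (\<Oplus>x\<in>?A \<times> ?B. ?f p x \<oplus> ?f p' x)"
    using p p' q by (intro finsum_cong' refl) (auto simp: F_apply l_distr)
  also have "\<dots> = (\<Oplus>x\<in>?A \<times> ?B. ?f p x) \<oplus> (\<Oplus>x\<in>?A \<times> ?B. ?f p' x)"
    using p p' q by (intro finsum_addf) auto
  also have "\<dots> = (p \<otimes>\<^bsub>F\<^esub> q) g \<oplus> (p' \<otimes>\<^bsub>F\<^esub> q) g"
    using p p' q fin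
    by (intro arg_cong2[where f = "add R"] convolution_eq[symmetric]) auto
  finally show "((p \<oplus>\<^bsub>F\<^esub> p') \<otimes>\<^bsub>F\<^esub> q) g = (p \<otimes>\<^bsub>F\<^esub> q \<oplus>\<^bsub>F\<^esub> p' \<otimes>\<^bsub>F\<^esub> q) g"
    by (simp add: F_apply)
qed

lemma F_r_distr:
  assumes p: "p \<in> carrier F" and p': "p' \<in> carrier F" and q: "q \<in> carrier F"
  shows "q \<otimes>\<^bsub>F\<^esub> (p \<oplus>\<^bsub>F\<^esub> p') = q \<otimes>\<^bsub>F\<^esub> p \<oplus>\<^bsub>F\<^esub> q \<otimes>\<^bsub>F\<^esub> p'"
proof
  fix g
  let ?A = "support p \<union> support p'" and ?B = "support q"
  let ?f = "\<lambda>p x. if fst x \<otimes>\<^bsub>G\<^esub> snd x = g then q (fst x) \<otimes> p (snd x) else \<zero>"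
  have fin: "finite ?A" "finite ?B"
    using p p' q by (auto simp: carrier_F_iff)
  have "(q \<otimes>\<^bsub>F\<^esub> (p \<oplus>\<^bsub>F\<^esub> p')) g = (\<Oplus>x\<in>?B \<times> ?A. ?f (p \<oplus>\<^bsub>F\<^esub> p') x)"
    using p p' q fin by (intro convolution_eq) (auto simp: F_apply)
  also have "\<dots> = (\<Oplus>x\<in>?B \<times> ?A. ?f p x \<oplus> ?f p' x)"
    using p p' q by (intro finsum_cong' refl) (auto simp: F_apply r_distr)
  also have "\<dots> = (\<Oplus>x\<in>?B \<times> ?A. ?f p x) \<oplus> (\<Oplus>x\<in>?B \<times> ?A. ?f p' x)"
    using p p' q by (intro finsum_addf) auto
  also have "\<dots> = (q \<otimes>\<^bsub>F\<^esub> p) g \<oplus> (q \<otimes>\<^bsub>F\<^esub> p') g"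
    using p p' q fin
    by (intro arg_cong2[where f = "add R"] convolution_eq[symmetric]) auto
  finally show "(q \<otimes>\<^bsub>F\<^esub> (p \<oplus>\<^bsub>F\<^esub> p')) g = (q \<otimes>\<^bsub>F\<^esub> p \<oplus>\<^bsub>F\<^esub> q \<otimes>\<^bsub>F\<^esub> p') g"
    by (simp add: F_apply)
qed

lemma F_smult_mult:
  assumes r: "r \<in> carrier R" and p: "p \<in> carrier F" and q: "q \<in> carrier F"
  shows "(r \<odot>\<^bsub>F\<^esub> p) \<otimes>\<^bsub>F\<^esub> q = r \<odot>\<^bsub>F\<^esub> (p \<otimes>\<^bsub>F\<^esub> q)"
    and "p \<otimes>\<^bsub>F\<^esub> (r \<odot>\<^bsub>F\<^esub> q) = r \<odot>\<^bsub>F\<^esub> (p \<otimes>\<^bsub>F\<^esub> q)"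
proof -
  have fin: "finite (support p)" "finite (support q)"
    using p q by (auto simp: carrier_F_iff)
  let ?f = "\<lambda>g p q x. if fst x \<otimes>\<^bsub>G\<^esub> snd x = g then p (fst x) \<otimes> q (snd x) else \<zero>"
  have pull: "(r \<odot>\<^bsub>F\<^esub> (p \<otimes>\<^bsub>F\<^esub> q)) g = (\<Oplus>x\<in>support p \<times> support q. r \<otimes> ?f g p q x)" for g
    unfolding F_apply(3) convolution_eq[OF p q fin subset_refl subset_refl]
    using r p q fin by (intro finsum_rdistr) auto
  show "(r \<odot>\<^bsub>F\<^esub> p) \<otimes>\<^bsub>F\<^esub> q = r \<odot>\<^bsub>F\<^esub> (p \<otimes>\<^bsub>F\<^esub> q)"
  proof
    fix g
    have "((r \<odot>\<^bsub>F\<^esub> p) \<otimes>\<^bsub>F\<^esub> q) g = (\<Oplus>x\<in>support p \<times> support q. ?f g (r \<odot>\<^bsub>F\<^esub> p) q x)"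
      using r p q fin by (intro convolution_eq) (auto simp: F_apply)
    also have "\<dots> = (\<Oplus>x\<in>support p \<times> support q. r \<otimes> ?f g p q x)"
      using r p q by (intro finsum_cong' refl) (auto simp: F_apply m_assoc)
    finally show "((r \<odot>\<^bsub>F\<^esub> p) \<otimes>\<^bsub>F\<^esub> q) g = (r \<odot>\<^bsub>F\<^esub> (p \<otimes>\<^bsub>F\<^esub> q)) g"
      unfolding pull .
  qed
  show "p \<otimes>\<^bsub>F\<^esub> (r \<odot>\<^bsub>F\<^esub> q) = r \<odot>\<^bsub>F\<^esub> (p \<otimes>\<^bsub>F\<^esub> q)"
  proof
    fix g
    have "(p \<otimes>\<^bsub>F\<^esub> (r \<odot>\<^bsub>F\<^esub> q)) g = (\<Oplus>x\<in>support p \<times> support q. ?f g p (r \<odot>\<^bsub>F\<^esub> q) x)"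
      using r p q fin by (intro convolution_eq) (auto simp: F_apply)
    also have "\<dots> = (\<Oplus>x\<in>support p \<times> support q. r \<otimes> ?f g p q x)"
      using r p q by (intro finsum_cong' refl) (auto simp: F_apply m_lcomm)
    finally show "(p \<otimes>\<^bsub>F\<^esub> (r \<odot>\<^bsub>F\<^esub> q)) g = (r \<odot>\<^bsub>F\<^esub> (p \<otimes>\<^bsub>F\<^esub> q)) g"
      unfolding pull .
  qed
qed

lemma basis_mult:
  assumes "a \<in> carrier G" "b \<in> carrier G"
  shows "basis_elem R a \<otimes>\<^bsub>F\<^esub> basis_elem R b = basis_elem R (a \<otimes>\<^bsub>G\<^esub> b)"
proof
  fix g
  have "(basis_elem R a \<otimes>\<^bsub>F\<^esub> basis_elem R b) g = (\<Oplus>x\<in>{a} \<times> {b}.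
      if fst x \<otimes>\<^bsub>G\<^esub> snd x = g then basis_elem R a (fst x) \<otimes> basis_elem R b (snd x) else \<zero>)"
    using assms by (intro convolution_eq) (auto simp: F_apply)
  then show "(basis_elem R a \<otimes>\<^bsub>F\<^esub> basis_elem R b) g = basis_elem R (a \<otimes>\<^bsub>G\<^esub> b) g"
    by (simp add: F_apply)
qed

text \<open>
  This reduces identities that are linear in a variable to basis elements.
\<close>

lemma basis_induct [consumes 1, case_names zero add basis]:
  assumes p: "p \<in> carrier F"
    and zero: "P \<zero>\<^bsub>F\<^esub>"
    and add: "\<And>p q. \<lbrakk>p \<in> carrier F; q \<in> carrier F; P p; P q\<rbrakk> \<Longrightarrow> P (p \<oplus>\<^bsub>F\<^esub> q)"
    and basis: "\<And>r g. \<lbrakk>r \<in> carrier R; g \<in> carrier G\<rbrakk> \<Longrightarrow> P (r \<odot>\<^bsub>F\<^esub> basis_elem R g)"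
  shows "P p"
proof -
  have "P p" if "finite S" "support p \<subseteq> S" "p \<in> carrier F" for S p
    using that
  proof (induction S arbitrary: p rule: finite_induct)
    case empty
    then have "p = \<zero>\<^bsub>F\<^esub>"
      by (auto simp: F_simps)
    then show ?case
      using zero by simp
  next
    case (insert g S)
    show ?case
    proof (cases "p g = \<zero>")
      case True
      then show ?thesis
        using insert by (intro insert.IH) auto
    next
      case False
      define p' where "p' = p(g := \<zero>)"
      have g: "g \<in> carrier G" and pg: "p g \<in> carrier R"
        using False insert.prems by (auto simp: carrier_F_iff)
      have "support p' \<subseteq> support p"
        by (auto simp: p'_def)
      then have p': "p' \<in> carrier F"
        using insert.prems by (auto simp: carrier_F_iff p'_def intro: finite_subset)
      have "p = p g \<odot>\<^bsub>F\<^esub> basis_elem R g \<oplus>\<^bsub>F\<^esub> p'"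
        using insert.prems(2) pg by (intro ext) (simp add: F_apply p'_def)
      moreover have "P p'"
        using insert.prems(1) by (intro insert.IH[OF _ p']) (auto simp: p'_def)
      ultimately show ?thesis
        using add[OF _ p' basis[OF pg g]] pg g by simp
    qed
  qed
  then show ?thesis
    using p by (auto simp: carrier_F_iff)
qed

sublocale F: nonunital_algebra R F
proof unfold_locales
  fix p q s assume p: "p \<in> carrier F" and q: "q \<in> carrier F" and s: "s \<in> carrier F"
  show "(p \<otimes>\<^bsub>F\<^esub> q) \<otimes>\<^bsub>F\<^esub> s = p \<otimes>\<^bsub>F\<^esub> (q \<otimes>\<^bsub>F\<^esub> s)"
    using p
  proof (induction p rule: basis_induct)
    case zero
    have "\<zero>\<^bsub>F\<^esub> \<otimes>\<^bsub>F\<^esub> t = \<zero>\<^bsub>F\<^esub>" if "t \<in> carrier F" for t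
      using F_smult_mult(1)[of \<zero> "\<zero>\<^bsub>F\<^esub>" t] that by simp
    then show ?case
      using q s by simp
  next
    case (add p p')
    then show ?case
      using q s by (simp add: F_l_distr)
  next
    case p: (basis r a)
    from q have "(basis_elem R a \<otimes>\<^bsub>F\<^esub> q) \<otimes>\<^bsub>F\<^esub> s = basis_elem R a \<otimes>\<^bsub>F\<^esub> (q \<otimes>\<^bsub>F\<^esub> s)"
    proof (induction q rule: basis_induct)
      case zero
      have "\<zero>\<^bsub>F\<^esub> \<otimes>\<^bsub>F\<^esub> t = \<zero>\<^bsub>F\<^esub>" "t \<otimes>\<^bsub>F\<^esub> \<zero>\<^bsub>F\<^esub> = \<zero>\<^bsub>F\<^esub>" if "t \<in> carrier F" for t
        using F_smult_mult(1)[of \<zero> "\<zero>\<^bsub>F\<^esub>" t] F_smult_mult(2)[of \<zero> t "\<zero>\<^bsub>F\<^esub>"] that by simp_all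
      then show ?case
        using p s by simp
    next
      case (add q q')
      then show ?case
        using p s by (simp add: F_l_distr F_r_distr)
    next
      case q: (basis r' b)
      from s have "(basis_elem R a \<otimes>\<^bsub>F\<^esub> basis_elem R b) \<otimes>\<^bsub>F\<^esub> s =
          basis_elem R a \<otimes>\<^bsub>F\<^esub> (basis_elem R b \<otimes>\<^bsub>F\<^esub> s)"
      proof (induction s rule: basis_induct)
        case zero
        have "t \<otimes>\<^bsub>F\<^esub> \<zero>\<^bsub>F\<^esub> = \<zero>\<^bsub>F\<^esub>" if "t \<in> carrier F" for t
          using F_smult_mult(2)[of \<zero> t "\<zero>\<^bsub>F\<^esub>"] that by simp
        then show ?case
          using p q by simp
      next
        case (add s s')
        then show ?case
          using p q by (simp add: F_r_distr)
      next
        case (basis r'' c)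
        then show ?case
          using p q by (simp add: F_smult_mult basis_mult op_assoc)
      qed
      then show ?case
        using p q s by (simp add: F_smult_mult)
    qed
    then show ?case
      using p q s by (simp add: F_smult_mult)
  qed
qed (simp_all add: F_l_distr F_r_distr F_smult_mult)

text \<open>
  Semigroup algebras are free as modules, so homomorphisms are determined on the basis.
\<close>

lemma hom_eq_on_basis:
  assumes B: "nonunital_algebra R B" and h: "h \<in> algebra_hom R F B" and k: "k \<in> algebra_hom R F B"
    and eq: "\<And>g. g \<in> carrier G \<Longrightarrow> h (basis_elem R g) = k (basis_elem R g)"
    and p: "p \<in> carrier F"
  shows "h p = k p"
proof -
  interpret h: algebra_homomorphism R F B h
    by (intro algebra_homomorphism.intro algebra_homomorphism_axioms.intro
        F.nonunital_algebra_axioms B h)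
  interpret k: algebra_homomorphism R F B k
    by (intro algebra_homomorphism.intro algebra_homomorphism_axioms.intro
        F.nonunital_algebra_axioms B k)
  from p show ?thesis
    by (induction p rule: basis_induct) (simp_all add: eq)
qed

definition linear_extension :: "('r, 'b) module \<Rightarrow> ('g \<Rightarrow> 'b) \<Rightarrow> ('g \<Rightarrow> 'r) \<Rightarrow> 'b" where
  "linear_extension B \<beta> p = (\<Oplus>\<^bsub>B\<^esub>g\<in>support p. p g \<odot>\<^bsub>B\<^esub> \<beta> g)"

text \<open>
  The universal property of a semigroup algebra: multiplicative maps from the semigroup extend to
  algebra homomorphisms.  Multiplicativity is bilinear in the two arguments, so it suffices to
  check it on basis elements, where it is the hypothesis on the map.
\<close>

lemma linear_extension_hom:
  assumes B: "nonunital_algebra R B"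
    and closed: "\<And>g. g \<in> carrier G \<Longrightarrow> \<beta> g \<in> carrier B"
    and mult: "\<And>a b. \<lbrakk>a \<in> carrier G; b \<in> carrier G\<rbrakk> \<Longrightarrow> \<beta> (a \<otimes>\<^bsub>G\<^esub> b) = \<beta> a \<otimes>\<^bsub>B\<^esub> \<beta> b"
  shows "linear_extension B \<beta> \<in> algebra_hom R F B"
    and "\<And>g. g \<in> carrier G \<Longrightarrow> linear_extension B \<beta> (basis_elem R g) = \<beta> g"
proof -
  interpret B: nonunital_algebra R B by fact
  let ?h = "linear_extension B \<beta>"
  have eq: "?h p = (\<Oplus>\<^bsub>B\<^esub>g\<in>S. p g \<odot>\<^bsub>B\<^esub> \<beta> g)"
    if "p \<in> carrier F" "finite S" "support p \<subseteq> S" "S \<subseteq> carrier G" for p S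
    unfolding linear_extension_def using that closed
    by (intro B.add.finprod_mono_neutral_cong_left) (auto simp: subset_iff)
  have h_closed: "?h p \<in> carrier B" if "p \<in> carrier F" for p
    unfolding linear_extension_def using that closed
    by (intro B.finsum_closed) (auto simp: carrier_F_iff)
  have h_add: "?h (p \<oplus>\<^bsub>F\<^esub> q) = ?h p \<oplus>\<^bsub>B\<^esub> ?h q" if p: "p \<in> carrier F" and q: "q \<in> carrier F" for p q
  proof -
    let ?S = "support p \<union> support q"
    have S: "finite ?S" "?S \<subseteq> carrier G"
      using p q by (auto simp: carrier_F_iff)
    have "?h (p \<oplus>\<^bsub>F\<^esub> q) = (\<Oplus>\<^bsub>B\<^esub>g\<in>?S. (p \<oplus>\<^bsub>F\<^esub> q) g \<odot>\<^bsub>B\<^esub> \<beta> g)"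
      using p q S by (intro eq) (auto simp: F_apply)
    also have "\<dots> = (\<Oplus>\<^bsub>B\<^esub>g\<in>?S. p g \<odot>\<^bsub>B\<^esub> \<beta> g \<oplus>\<^bsub>B\<^esub> q g \<odot>\<^bsub>B\<^esub> \<beta> g)"
      using p q S closed
      by (intro B.finsum_cong') (auto simp: F_apply B.smult_l_distr subset_iff)
    also have "\<dots> = (\<Oplus>\<^bsub>B\<^esub>g\<in>?S. p g \<odot>\<^bsub>B\<^esub> \<beta> g) \<oplus>\<^bsub>B\<^esub> (\<Oplus>\<^bsub>B\<^esub>g\<in>?S. q g \<odot>\<^bsub>B\<^esub> \<beta> g)"
      using p q S closed by (intro B.finsum_addf) (auto simp: subset_iff)
    also have "\<dots> = ?h p \<oplus>\<^bsub>B\<^esub> ?h q"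
      using p q S by (simp add: eq[of _ ?S])
    finally show ?thesis .
  qed
  have h_smult: "?h (r \<odot>\<^bsub>F\<^esub> p) = r \<odot>\<^bsub>B\<^esub> ?h p" if r: "r \<in> carrier R" and p: "p \<in> carrier F" for r p
  proof -
    let ?S = "support p"
    have S: "finite ?S" "?S \<subseteq> carrier G"
      using p by (auto simp: carrier_F_iff)
    have "?h (r \<odot>\<^bsub>F\<^esub> p) = (\<Oplus>\<^bsub>B\<^esub>g\<in>?S. (r \<odot>\<^bsub>F\<^esub> p) g \<odot>\<^bsub>B\<^esub> \<beta> g)"
      using r p S by (intro eq) (auto simp: F_apply)
    also have "\<dots> = (\<Oplus>\<^bsub>B\<^esub>g\<in>?S. r \<odot>\<^bsub>B\<^esub> (p g \<odot>\<^bsub>B\<^esub> \<beta> g))"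
      using r p S closed
      by (intro B.finsum_cong') (auto simp: F_apply B.smult_assoc1 subset_iff)
    also have "\<dots> = r \<odot>\<^bsub>B\<^esub> ?h p"
      unfolding linear_extension_def using r p S closed
      by (intro B.finsum_smult_ldistr[symmetric]) (auto simp: subset_iff)
    finally show ?thesis .
  qed
  show h_basis: "?h (basis_elem R g) = \<beta> g" if "g \<in> carrier G" for g
    using that closed by (subst eq[of _ "{g}"]) (auto simp: F_apply)
  have h_zero: "?h \<zero>\<^bsub>F\<^esub> = \<zero>\<^bsub>B\<^esub>"
    by (simp add: linear_extension_def F_apply)
  have h_mult: "?h (p \<otimes>\<^bsub>F\<^esub> q) = ?h p \<otimes>\<^bsub>B\<^esub> ?h q" if p: "p \<in> carrier F" and q: "q \<in> carrier F" for p q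
    using p
  proof (induction p rule: basis_induct)
    case zero
    then show ?case
      using q by (simp add: h_zero h_closed)
  next
    case (add p p')
    then show ?case
      using q by (simp add: F.mult_l_distr B.mult_l_distr h_add h_closed)
  next
    case p: (basis r a)
    from q have "?h (basis_elem R a \<otimes>\<^bsub>F\<^esub> q) = \<beta> a \<otimes>\<^bsub>B\<^esub> ?h q"
    proof (induction q rule: basis_induct)
      case zero
      then show ?case
        using p closed by (simp add: h_zero)
    next
      case (add q q')
      then show ?case
        using p closed by (simp add: F.mult_r_distr B.mult_r_distr h_add h_closed)
    next
      case (basis r' b)
      then show ?case
        using p closed
        by (simp add: F.smult_mult_right B.smult_mult_right h_smult basis_mult h_basis mult)
    qed
    then show ?case
      using p q closed
      by (simp add: F.smult_mult_left B.smult_mult_left h_smult h_basis h_closed)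
  qed
  show "?h \<in> algebra_hom R F B"
    by (intro algebra_homI h_closed h_add h_mult h_smult)
qed

end


section \<open>Free algebras\<close>

text \<open>
  The value at the empty word is a dummy, since the free semigroup contains nonempty words only and
  \<open>A\<close> need not have a unit.
\<close>

fun word_value :: "('a, 'm) monoid_scheme \<Rightarrow> ('x \<Rightarrow> 'a) \<Rightarrow> 'x list \<Rightarrow> 'a" where
  "word_value A u [] = \<one>\<^bsub>A\<^esub>"
| "word_value A u [x] = u x"
| "word_value A u (x # y # w) = u x \<otimes>\<^bsub>A\<^esub> word_value A u (y # w)"

lemma word_value_Cons: "w \<noteq> [] \<Longrightarrow> word_value A u (x # w) = u x \<otimes>\<^bsub>A\<^esub> word_value A u w"
  by (cases w) auto

lemma (in nonunital_algebra) word_value_closed: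
  assumes "\<And>x. x \<in> X \<Longrightarrow> u x \<in> carrier A"
  shows "\<lbrakk>w \<in> lists X; w \<noteq> []\<rbrakk> \<Longrightarrow> word_value A u w \<in> carrier A"
proof (induction w)
  case (Cons x w)
  then show ?case
    using assms by (cases "w = []") (auto simp: word_value_Cons)
qed simp

lemma (in nonunital_algebra) word_value_append:
  assumes u: "\<And>x. x \<in> X \<Longrightarrow> u x \<in> carrier A" and w': "w' \<in> lists X" "w' \<noteq> []"
  shows "\<lbrakk>w \<in> lists X; w \<noteq> []\<rbrakk> \<Longrightarrow>
    word_value A u (w @ w') = word_value A u w \<otimes>\<^bsub>A\<^esub> word_value A u w'"
proof (induction w)
  case (Cons x w)
  show ?case
  proof (cases "w = []")
    case True
    then show ?thesis
      using w' by (simp add: word_value_Cons)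
  next
    case False
    then show ?thesis
      using Cons u w' by (simp add: word_value_Cons word_value_closed[OF u] mult_assoc)
  qed
qed simp

lemma semigroup_algebra_free_semigroup:
  assumes "cring R"
  shows "semigroup_algebra R (free_semigroup X)"
  using assms by (auto simp: semigroup_algebra_def semigroup_algebra_axioms_def free_semigroup_def)

lemma free_algebra_is_algebra:
  assumes "cring R"
  shows "nonunital_algebra R (free_algebra R X)"
proof -
  interpret semigroup_algebra R "free_semigroup X"
    using assms by (rule semigroup_algebra_free_semigroup)
  show ?thesis
    unfolding free_algebra_def by (rule F.nonunital_algebra_axioms)
qed

lemma generator_closed:
  assumes "cring R" "x \<in> X"
  shows "basis_elem R [x] \<in> carrier (free_algebra R X)"
proof -
  interpret semigroup_algebra R "free_semigroup X"
    using assms(1) by (rule semigroup_algebra_free_semigroup)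
  show ?thesis
    using assms(2) unfolding free_algebra_def by (intro basis_closed) (simp add: free_semigroup_def)
qed

lemma free_algebra_lift:
  assumes B: "nonunital_algebra R B" and u: "\<And>x. x \<in> X \<Longrightarrow> u x \<in> carrier B"
  obtains h where "h \<in> algebra_hom R (free_algebra R X) B"
    "\<And>x. x \<in> X \<Longrightarrow> h (basis_elem R [x]) = u x"
proof -
  interpret B: nonunital_algebra R B by fact
  interpret semigroup_algebra R "free_semigroup X"
    by (intro semigroup_algebra_free_semigroup B.is_cring)
  let ?W = "free_semigroup X"
  have closed: "word_value B u w \<in> carrier B" if "w \<in> carrier ?W" for w
    using that B.word_value_closed[of X u, OF u] by (auto simp: free_semigroup_def)
  have mult: "word_value B u (w \<otimes>\<^bsub>?W\<^esub> w') = word_value B u w \<otimes>\<^bsub>B\<^esub> word_value B u w'"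
    if "w \<in> carrier ?W" "w' \<in> carrier ?W" for w w'
    using that B.word_value_append[of X u, OF u] by (simp add: free_semigroup_def)
  have "linear_extension B (word_value B u) \<in> algebra_hom R (free_algebra R X) B"
    unfolding free_algebra_def by (intro linear_extension_hom(1)[OF B] closed mult)
  moreover have "linear_extension B (word_value B u) (basis_elem R [x]) = u x" if "x \<in> X" for x
  proof -
    have "linear_extension B (word_value B u) (basis_elem R [x]) = word_value B u [x]"
      using that
      by (intro linear_extension_hom(2)[OF B] closed mult) (simp_all add: free_semigroup_def)
    then show ?thesis
      by simp
  qed
  ultimately show thesis
    using that by blast
qed

lemma free_algebra_hom_eq:
  assumes B: "nonunital_algebra R B"
    and h: "h \<in> algebra_hom R (free_algebra R X) B" and k: "k \<in> algebra_hom R (free_algebra R X) B"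
    and eq: "\<And>x. x \<in> X \<Longrightarrow> h (basis_elem R [x]) = k (basis_elem R [x])"
    and p: "p \<in> carrier (free_algebra R X)"
  shows "h p = k p"
proof -
  interpret B: nonunital_algebra R B by fact
  interpret semigroup_algebra R "free_semigroup X"
    by (intro semigroup_algebra_free_semigroup B.is_cring)
  note hF = h[unfolded free_algebra_def] and kF = k[unfolded free_algebra_def]
  \<comment> \<open>Basis elements of the free algebra are words, hence products of generators; the induction is
    over the inductive set of lists with entries in \<open>X\<close>.\<close>
  have words: "h (basis_elem R w) = k (basis_elem R w)" if "w \<in> lists X" "w \<noteq> []" for w
    using that
  proof (induction w)
    case (Cons x w)
    show ?case
    proof (cases "w = []")
      case True
      then show ?thesis
        using Cons eq by simp
    next
      case False
      have carrier: "[x] \<in> carrier (free_semigroup X)" "w \<in> carrier (free_semigroup X)"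
        using Cons.hyps False by (simp_all add: free_semigroup_def)
      have "basis_elem R (x # w) = basis_elem R [x] \<otimes>\<^bsub>F\<^esub> basis_elem R w"
        using basis_mult[OF carrier] by (simp add: free_semigroup_def)
      then show ?thesis
        using Cons False eq carrier algebra_homD(3)[OF hF] algebra_homD(3)[OF kF] by simp
    qed
  qed simp
  show ?thesis
    by (rule hom_eq_on_basis[OF B hF kF]) (use words p in \<open>auto simp: free_semigroup_def free_algebra_def\<close>)
qed


section \<open>The universal property of Leavitt path algebras\<close>

text \<open>
  The defining relations, read in an arbitrary algebra.  Taking only a \<^type>\<open>ring\<close> as argument
  records that scalars do not occur in them; the transport between base rings rests on this.
\<close>

definition leavitt_family ::
  "('a, 'm) ring_scheme \<Rightarrow> ('v, 'e) pre_digraph \<Rightarrow> (('v, 'e) lpa_gen \<Rightarrow> 'a) \<Rightarrow> bool" where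
  "leavitt_family A E u \<longleftrightarrow> u ` lpa_gens E \<subseteq> carrier A \<and>
     (\<forall>v\<in>verts E. \<forall>w\<in>verts E.
        u (Vertex v) \<otimes>\<^bsub>A\<^esub> u (Vertex w) = (if v = w then u (Vertex v) else \<zero>\<^bsub>A\<^esub>)) \<and>
     (\<forall>e\<in>arcs E. u (Vertex (tail E e)) \<otimes>\<^bsub>A\<^esub> u (Edge e) = u (Edge e)) \<and>
     (\<forall>e\<in>arcs E. u (Edge e) \<otimes>\<^bsub>A\<^esub> u (Vertex (head E e)) = u (Edge e)) \<and>
     (\<forall>e\<in>arcs E. u (Vertex (head E e)) \<otimes>\<^bsub>A\<^esub> u (Ghost e) = u (Ghost e)) \<and>
     (\<forall>e\<in>arcs E. u (Ghost e) \<otimes>\<^bsub>A\<^esub> u (Vertex (tail E e)) = u (Ghost e)) \<and>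
     (\<forall>e\<in>arcs E. \<forall>f\<in>arcs E.
        u (Ghost e) \<otimes>\<^bsub>A\<^esub> u (Edge f) = (if e = f then u (Vertex (head E e)) else \<zero>\<^bsub>A\<^esub>)) \<and>
     (\<forall>v\<in>regular_verts E.
        u (Vertex v) = (\<Oplus>\<^bsub>A\<^esub>e\<in>out_arcs E v. u (Edge e) \<otimes>\<^bsub>A\<^esub> u (Ghost e)))"

lemma leavitt_family_closed: "\<lbrakk>leavitt_family A E u; x \<in> lpa_gens E\<rbrakk> \<Longrightarrow> u x \<in> carrier A"
  by (auto simp: leavitt_family_def)

lemma lpa_gensI [simp]:
  "v \<in> verts E \<Longrightarrow> Vertex v \<in> lpa_gens E"
  "e \<in> arcs E \<Longrightarrow> Edge e \<in> lpa_gens E"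
  "e \<in> arcs E \<Longrightarrow> Ghost e \<in> lpa_gens E"
  by (auto simp: lpa_gens_def)

lemma ball_setcompr:
  "(\<forall>x\<in>{f v |v. P v}. Q x) \<longleftrightarrow> (\<forall>v. P v \<longrightarrow> Q (f v))"
  "(\<forall>x\<in>{g v w |v w. S v w}. Q x) \<longleftrightarrow> (\<forall>v w. S v w \<longrightarrow> Q (g v w))"
  by blast+

lemma leavitt_family_cong:
  assumes E: "wf_digraph E" and eq: "\<And>x. x \<in> lpa_gens E \<Longrightarrow> u x = u' x"
    and u: "leavitt_family A E u" and A: "nonunital_algebra R A"
  shows "leavitt_family A E u'"
proof -
  interpret nonunital_algebra R A by fact
  have verts [simp]: "tail E e \<in> verts E" "head E e \<in> verts E" if "e \<in> arcs E" for e
    using that wf_digraph.tail_in_verts[OF E] wf_digraph.head_in_verts[OF E] by auto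
  have "(\<Oplus>\<^bsub>A\<^esub>e\<in>out_arcs E v. u' (Edge e) \<otimes>\<^bsub>A\<^esub> u' (Ghost e)) =
      (\<Oplus>\<^bsub>A\<^esub>e\<in>out_arcs E v. u (Edge e) \<otimes>\<^bsub>A\<^esub> u (Ghost e))" for v
    using leavitt_family_closed[OF u]
    by (intro finsum_cong' refl) (auto simp: eq[symmetric])
  moreover have "v \<in> verts E" if "v \<in> regular_verts E" for v
    using that by (simp add: regular_verts_def)
  ultimately show ?thesis
    using u unfolding leavitt_family_def by (auto simp: eq[symmetric])
qed

text \<open>
  The second claim translates between relators, which are differences in the free algebra, and
  relations, which are equations in the target.  It is used in both directions: for the projection
  onto the quotient it shows that the canonical generators satisfy the relations, and for a map
  that extends a given family it shows that the map factors through the quotient.  That the graph is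
  well formed is what makes sources and ranges of edges available as generators.
\<close>

lemma relators_carrier_and_kernel:
  assumes R: "cring R" and E: "wf_digraph E"
  shows relators_closed: "lpa_relators R E \<subseteq> carrier (free_algebra R (lpa_gens E))"
    and kills_relators_iff: "\<lbrakk>nonunital_algebra R B; h \<in> algebra_hom R (free_algebra R (lpa_gens E)) B\<rbrakk> \<Longrightarrow>
      (\<forall>x\<in>lpa_relators R E. h x = \<zero>\<^bsub>B\<^esub>) \<longleftrightarrow> leavitt_family B E (\<lambda>x. h (basis_elem R [x]))"
proof -
  let ?F = "free_algebra R (lpa_gens E)"
  interpret F: nonunital_algebra R ?F
    using R by (rule free_algebra_is_algebra)
  note gen [simp] = generator_closed[OF R, of _ "lpa_gens E"]
  have verts [simp]: "tail E e \<in> verts E" "head E e \<in> verts E" if "e \<in> arcs E" for e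
    using that wf_digraph.tail_in_verts[OF E] wf_digraph.head_in_verts[OF E] by auto
  have out: "e \<in> arcs E" if "e \<in> out_arcs E v" for e v
    using that by (simp add: out_arcs_def)
  have reg [simp]: "v \<in> verts E" if "v \<in> regular_verts E" for v
    using that by (simp add: regular_verts_def)
  have sum [simp]: "(\<lambda>e. basis_elem R [Edge e] \<otimes>\<^bsub>?F\<^esub> basis_elem R [Ghost e]) \<in> out_arcs E v \<rightarrow> carrier ?F" for v
    by (auto dest: out)
  note sum_closed [simp] = F.finsum_closed[OF sum]
  show "lpa_relators R E \<subseteq> carrier ?F"
    by (auto simp: lpa_relators_def Let_def)
  assume B: "nonunital_algebra R B" and h: "h \<in> algebra_hom R ?F B"
  interpret h: algebra_homomorphism R ?F B h
    by (intro algebra_homomorphism.intro algebra_homomorphism_axioms.intro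
        F.nonunital_algebra_axioms B h)
  have sum_eq: "(\<Oplus>\<^bsub>B\<^esub>e\<in>out_arcs E v. h (basis_elem R [Edge e] \<otimes>\<^bsub>?F\<^esub> basis_elem R [Ghost e])) =
    (\<Oplus>\<^bsub>B\<^esub>e\<in>out_arcs E v. h (basis_elem R [Edge e]) \<otimes>\<^bsub>B\<^esub> h (basis_elem R [Ghost e]))" for v
    by (intro h.B.finsum_cong' refl) (auto dest: out)
  have closed: "(\<lambda>x. h (basis_elem R [x])) ` lpa_gens E \<subseteq> carrier B"
    by auto
  let ?d = "\<lambda>x. basis_elem R [x]"
  have relations:
    "(\<forall>v w. v \<in> verts E \<and> w \<in> verts E \<longrightarrow>
      h (?d (Vertex v) \<otimes>\<^bsub>?F\<^esub> ?d (Vertex w) \<ominus>\<^bsub>?F\<^esub> (if v = w then ?d (Vertex v) else \<zero>\<^bsub>?F\<^esub>)) = \<zero>\<^bsub>B\<^esub>) \<longleftrightarrow>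
     (\<forall>v\<in>verts E. \<forall>w\<in>verts E.
      h (?d (Vertex v)) \<otimes>\<^bsub>B\<^esub> h (?d (Vertex w)) = (if v = w then h (?d (Vertex v)) else \<zero>\<^bsub>B\<^esub>))"
    "(\<forall>e. e \<in> arcs E \<longrightarrow> h (?d (Vertex (tail E e)) \<otimes>\<^bsub>?F\<^esub> ?d (Edge e) \<ominus>\<^bsub>?F\<^esub> ?d (Edge e)) = \<zero>\<^bsub>B\<^esub>) \<longleftrightarrow>
     (\<forall>e\<in>arcs E. h (?d (Vertex (tail E e))) \<otimes>\<^bsub>B\<^esub> h (?d (Edge e)) = h (?d (Edge e)))"
    "(\<forall>e. e \<in> arcs E \<longrightarrow> h (?d (Edge e) \<otimes>\<^bsub>?F\<^esub> ?d (Vertex (head E e)) \<ominus>\<^bsub>?F\<^esub> ?d (Edge e)) = \<zero>\<^bsub>B\<^esub>) \<longleftrightarrow>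
     (\<forall>e\<in>arcs E. h (?d (Edge e)) \<otimes>\<^bsub>B\<^esub> h (?d (Vertex (head E e))) = h (?d (Edge e)))"
    "(\<forall>e. e \<in> arcs E \<longrightarrow> h (?d (Vertex (head E e)) \<otimes>\<^bsub>?F\<^esub> ?d (Ghost e) \<ominus>\<^bsub>?F\<^esub> ?d (Ghost e)) = \<zero>\<^bsub>B\<^esub>) \<longleftrightarrow>
     (\<forall>e\<in>arcs E. h (?d (Vertex (head E e))) \<otimes>\<^bsub>B\<^esub> h (?d (Ghost e)) = h (?d (Ghost e)))"
    "(\<forall>e. e \<in> arcs E \<longrightarrow> h (?d (Ghost e) \<otimes>\<^bsub>?F\<^esub> ?d (Vertex (tail E e)) \<ominus>\<^bsub>?F\<^esub> ?d (Ghost e)) = \<zero>\<^bsub>B\<^esub>) \<longleftrightarrow>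
     (\<forall>e\<in>arcs E. h (?d (Ghost e)) \<otimes>\<^bsub>B\<^esub> h (?d (Vertex (tail E e))) = h (?d (Ghost e)))"
    "(\<forall>e f. e \<in> arcs E \<and> f \<in> arcs E \<longrightarrow>
      h (?d (Ghost e) \<otimes>\<^bsub>?F\<^esub> ?d (Edge f) \<ominus>\<^bsub>?F\<^esub> (if e = f then ?d (Vertex (head E e)) else \<zero>\<^bsub>?F\<^esub>)) = \<zero>\<^bsub>B\<^esub>) \<longleftrightarrow>
     (\<forall>e\<in>arcs E. \<forall>f\<in>arcs E.
      h (?d (Ghost e)) \<otimes>\<^bsub>B\<^esub> h (?d (Edge f)) = (if e = f then h (?d (Vertex (head E e))) else \<zero>\<^bsub>B\<^esub>))"
    "(\<forall>v. v \<in> regular_verts E \<longrightarrow>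
      h (?d (Vertex v) \<ominus>\<^bsub>?F\<^esub> (\<Oplus>\<^bsub>?F\<^esub>e\<in>out_arcs E v. ?d (Edge e) \<otimes>\<^bsub>?F\<^esub> ?d (Ghost e))) = \<zero>\<^bsub>B\<^esub>) \<longleftrightarrow>
     (\<forall>v\<in>regular_verts E.
      h (?d (Vertex v)) = (\<Oplus>\<^bsub>B\<^esub>e\<in>out_arcs E v. h (?d (Edge e)) \<otimes>\<^bsub>B\<^esub> h (?d (Ghost e))))"
    by (auto simp: h.hom_minus_eq_zero_iff h.hom_finsum sum_eq)
  show "(\<forall>x\<in>lpa_relators R E. h x = \<zero>\<^bsub>B\<^esub>) \<longleftrightarrow> leavitt_family B E (\<lambda>x. h (?d x))"
    unfolding lpa_relators_def Let_def ball_Un ball_setcompr relations leavitt_family_def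
    using closed by simp
qed


abbreviation lpa_generator ::
  "('r, 'm) ring_scheme \<Rightarrow> ('v, 'e) pre_digraph \<Rightarrow> ('v, 'e) lpa_gen \<Rightarrow> (('v, 'e) lpa_gen list \<Rightarrow> 'r) set" where
  "lpa_generator R E x \<equiv> generated_ideal R (free_algebra R (lpa_gens E)) (lpa_relators R E)
     +>\<^bsub>free_algebra R (lpa_gens E)\<^esub> basis_elem R [x]"

lemma lpa_algebra_with_ideal:
  assumes R: "cring R" and E: "wf_digraph E"
  shows "algebra_with_ideal R (free_algebra R (lpa_gens E))
    (generated_ideal R (free_algebra R (lpa_gens E)) (lpa_relators R E))"
proof (intro algebra_with_ideal.intro algebra_with_ideal_axioms.intro)
  show F: "nonunital_algebra R (free_algebra R (lpa_gens E))"
    using R by (rule free_algebra_is_algebra)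
  show "algebra_ideal R (free_algebra R (lpa_gens E))
      (generated_ideal R (free_algebra R (lpa_gens E)) (lpa_relators R E))"
    by (rule nonunital_algebra.generated_ideal_is_ideal[OF F relators_closed[OF R E]])
qed

lemma lpa_is_algebra:
  assumes R: "cring R" and E: "wf_digraph E"
  shows "nonunital_algebra R (leavitt_path_algebra R E)"
  using algebra_with_ideal.quotient_is_algebra[OF lpa_algebra_with_ideal[OF assms]]
  by (simp add: leavitt_path_algebra_def Let_def)

lemma lpa_generators_leavitt_family:
  assumes R: "cring R" and E: "wf_digraph E"
  shows "leavitt_family (leavitt_path_algebra R E) E (lpa_generator R E)"
proof -
  let ?F = "free_algebra R (lpa_gens E)"
  let ?I = "generated_ideal R ?F (lpa_relators R E)"
  interpret algebra_with_ideal R ?F ?I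
    by (rule lpa_algebra_with_ideal[OF assms])
  have "proj x = \<zero>\<^bsub>quotient_algebra ?F ?I\<^esub>" if x: "x \<in> lpa_relators R E" for x
  proof -
    have "x \<in> carrier ?F" "x \<in> ?I"
      using subsetD[OF relators_closed[OF assms] x] subsetD[OF generated_ideal_superset x] by simp_all
    then show ?thesis
      by (simp add: proj_eq_zero_iff)
  qed
  then show ?thesis
    using kills_relators_iff[OF assms quotient_is_algebra proj_hom]
    by (simp add: leavitt_path_algebra_def Let_def)
qed

text \<open>
  Existence in the universal property: the extension of the family to the free algebra kills the
  relators, so its kernel is an ideal that contains them.
\<close>

lemma lpa_lift:
  assumes R: "cring R" and E: "wf_digraph E" and B: "nonunital_algebra R B"
    and u: "leavitt_family B E u"
  obtains h where "h \<in> algebra_hom R (leavitt_path_algebra R E) B"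
    "\<And>x. x \<in> lpa_gens E \<Longrightarrow> h (lpa_generator R E x) = u x"
proof -
  let ?F = "free_algebra R (lpa_gens E)"
  let ?I = "generated_ideal R ?F (lpa_relators R E)"
  interpret algebra_with_ideal R ?F ?I
    by (rule lpa_algebra_with_ideal[OF R E])
  obtain k where k: "k \<in> algebra_hom R ?F B" and ku: "\<And>x. x \<in> lpa_gens E \<Longrightarrow> k (basis_elem R [x]) = u x"
    by (rule free_algebra_lift[where X = "lpa_gens E" and u = u, OF B leavitt_family_closed[OF u]]) blast+
  interpret k: algebra_homomorphism R ?F B k
    by (intro algebra_homomorphism.intro algebra_homomorphism_axioms.intro
        nonunital_algebra_axioms B k)
  have "leavitt_family B E (\<lambda>x. k (basis_elem R [x]))"
    by (rule leavitt_family_cong[OF E _ u B]) (simp add: ku)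
  then have "\<forall>x\<in>lpa_relators R E. k x = \<zero>\<^bsub>B\<^esub>"
    using kills_relators_iff[OF R E B k] by simp
  then have "?I \<subseteq> {x \<in> carrier ?F. k x = \<zero>\<^bsub>B\<^esub>}"
    using relators_closed[OF R E] by (intro generated_ideal_least k.kernel_is_ideal) auto
  then have kill: "k x = \<zero>\<^bsub>B\<^esub>" if "x \<in> ?I" for x
    using that by blast
  obtain h where h: "h \<in> algebra_hom R (quotient_algebra ?F ?I) B"
    and hk: "\<And>x. x \<in> carrier ?F \<Longrightarrow> h (proj x) = k x"
    by (rule quotient_lift[OF B k kill]) blast+
  show thesis
  proof (rule that)
    show "h \<in> algebra_hom R (leavitt_path_algebra R E) B"
      using h by (simp add: leavitt_path_algebra_def Let_def)
    show "h (lpa_generator R E x) = u x" if "x \<in> lpa_gens E" for x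
      using hk[OF generator_closed[OF R that]] ku[OF that] by simp
  qed
qed

text \<open>
  Uniqueness in the universal property: every element of the quotient lifts to the free algebra,
  where a homomorphism is determined by the generators.
\<close>

lemma lpa_hom_eq:
  assumes R: "cring R" and E: "wf_digraph E" and B: "nonunital_algebra R B"
    and h: "h \<in> algebra_hom R (leavitt_path_algebra R E) B"
    and k: "k \<in> algebra_hom R (leavitt_path_algebra R E) B"
    and eq: "\<And>x. x \<in> lpa_gens E \<Longrightarrow> h (lpa_generator R E x) = k (lpa_generator R E x)"
    and a: "a \<in> carrier (leavitt_path_algebra R E)"
  shows "h a = k a"
proof -
  let ?F = "free_algebra R (lpa_gens E)"
  let ?I = "generated_ideal R ?F (lpa_relators R E)"
  interpret algebra_with_ideal R ?F ?I
    by (rule lpa_algebra_with_ideal[OF R E])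
  have L: "leavitt_path_algebra R E = quotient_algebra ?F ?I"
    by (simp add: leavitt_path_algebra_def Let_def)
  obtain p where p: "p \<in> carrier ?F" "a = proj p"
    using a unfolding L by (rule quotient_carrierE)
  have "h (proj p) = k (proj p)"
  proof (rule free_algebra_hom_eq[OF B _ _ _ p(1)])
    show "(\<lambda>x. h (proj x)) \<in> algebra_hom R ?F B"
      by (rule algebra_hom_comp[OF proj_hom h[unfolded L]])
    show "(\<lambda>x. k (proj x)) \<in> algebra_hom R ?F B"
      by (rule algebra_hom_comp[OF proj_hom k[unfolded L]])
  qed (rule eq)
  then show ?thesis
    using p by simp
qed


section \<open>Base change\<close>

definition restrict_scalars :: "('r \<Rightarrow> 's) \<Rightarrow> ('s, 'a) module \<Rightarrow> ('r, 'a) module" where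
  "restrict_scalars f A =
     \<lparr>carrier = carrier A, mult = mult A, one = one A, zero = zero A, add = add A,
      smult = (\<lambda>r. smult A (f r))\<rparr>"

lemma restrict_scalars_simps [simp]:
  "carrier (restrict_scalars f A) = carrier A"
  "mult (restrict_scalars f A) = mult A"
  "zero (restrict_scalars f A) = zero A"
  "add (restrict_scalars f A) = add A"
  "smult (restrict_scalars f A) = (\<lambda>r. smult A (f r))"
  "finsum (restrict_scalars f A) = finsum A"
  \<comment> \<open>The two additive monoids are records with different extension types, so that they can be
    compared only after unfolding the finite products over them.\<close>
  by (simp_all add: restrict_scalars_def finsum_def finprod_def fun_eq_iff)

text \<open>
  This holds because no scalars occur in the relations; it is the step that links the universal
  properties over the two base rings.
\<close>

lemma leavitt_family_restrict_scalars [simp]: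
  "leavitt_family (restrict_scalars f A) E u \<longleftrightarrow> leavitt_family A E u"
  by (simp add: leavitt_family_def)

lemma restrict_scalars_algebra:
  assumes R: "cring R" and f: "f \<in> ring_hom R S" and A: "nonunital_algebra S A"
  shows "nonunital_algebra R (restrict_scalars f A)"
proof -
  interpret A: nonunital_algebra S A by fact
  note [simp] = ring_hom_closed[OF f] ring_hom_add[OF f] ring_hom_mult[OF f] ring_hom_one[OF f]
  have "abelian_group (restrict_scalars f A)"
  proof (rule abelian_groupI)
    fix x assume "x \<in> carrier (restrict_scalars f A)"
    then show "\<exists>y\<in>carrier (restrict_scalars f A).
        y \<oplus>\<^bsub>restrict_scalars f A\<^esub> x = \<zero>\<^bsub>restrict_scalars f A\<^esub>"
      using A.l_neg A.a_inv_closed by auto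
  qed (simp_all add: A.a_ac)
  then have "Module.module R (restrict_scalars f A)"
    by (intro moduleI R)
      (simp_all add: A.smult_l_distr A.smult_r_distr A.smult_assoc1)
  then show ?thesis
    by (intro nonunital_algebra.intro nonunital_algebra_axioms.intro)
      (simp_all add: A.mult_assoc A.mult_l_distr A.mult_r_distr A.smult_mult_left A.smult_mult_right)
qed

lemma algebra_hom_restrict_scalars:
  assumes "f \<in> ring_hom R S" "h \<in> algebra_hom S A B"
  shows "h \<in> algebra_hom R (restrict_scalars f A) (restrict_scalars f B)"
  using assms ring_hom_closed[OF assms(1)] by (auto simp: algebra_hom_def)

lemma leavitt_family_image:
  assumes A: "nonunital_algebra R A" and B: "nonunital_algebra R B" and h: "h \<in> algebra_hom R A B"
    and E: "wf_digraph E" and u: "leavitt_family A E u"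
  shows "leavitt_family B E (\<lambda>x. h (u x))"
proof -
  interpret h: algebra_homomorphism R A B h
    by (intro algebra_homomorphism.intro algebra_homomorphism_axioms.intro A B h)
  have verts [simp]: "tail E e \<in> verts E" "head E e \<in> verts E" if "e \<in> arcs E" for e
    using that wf_digraph.tail_in_verts[OF E] wf_digraph.head_in_verts[OF E] by auto
  note [simp] = leavitt_family_closed[OF u]
  have "h (u (Vertex v)) = (\<Oplus>\<^bsub>B\<^esub>e\<in>out_arcs E v. h (u (Edge e)) \<otimes>\<^bsub>B\<^esub> h (u (Ghost e)))"
    if "v \<in> regular_verts E" for v
  proof -
    have "h (u (Vertex v)) = h (\<Oplus>\<^bsub>A\<^esub>e\<in>out_arcs E v. u (Edge e) \<otimes>\<^bsub>A\<^esub> u (Ghost e))"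
      using u that by (simp add: leavitt_family_def)
    also have "\<dots> = (\<Oplus>\<^bsub>B\<^esub>e\<in>out_arcs E v. h (u (Edge e) \<otimes>\<^bsub>A\<^esub> u (Ghost e)))"
      by (rule h.hom_finsum) auto
    also have "\<dots> = (\<Oplus>\<^bsub>B\<^esub>e\<in>out_arcs E v. h (u (Edge e)) \<otimes>\<^bsub>B\<^esub> h (u (Ghost e)))"
      by (intro h.B.finsum_cong' refl) auto
    finally show ?thesis .
  qed
  moreover have "h (u (Vertex v)) \<otimes>\<^bsub>B\<^esub> h (u (Vertex w)) = (if v = w then h (u (Vertex v)) else \<zero>\<^bsub>B\<^esub>)"
    if "v \<in> verts E" "w \<in> verts E" for v w
    using u that by (simp add: leavitt_family_def flip: h.hom_simps(3))
  moreover have "h (u (Ghost e)) \<otimes>\<^bsub>B\<^esub> h (u (Edge f)) = (if e = f then h (u (Vertex (head E e))) else \<zero>\<^bsub>B\<^esub>)"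
    if "e \<in> arcs E" "f \<in> arcs E" for e f
    using u that by (simp add: leavitt_family_def flip: h.hom_simps(3))
  moreover have "h (u (Vertex (tail E e))) \<otimes>\<^bsub>B\<^esub> h (u (Edge e)) = h (u (Edge e))"
    "h (u (Edge e)) \<otimes>\<^bsub>B\<^esub> h (u (Vertex (head E e))) = h (u (Edge e))"
    "h (u (Vertex (head E e))) \<otimes>\<^bsub>B\<^esub> h (u (Ghost e)) = h (u (Ghost e))"
    "h (u (Ghost e)) \<otimes>\<^bsub>B\<^esub> h (u (Vertex (tail E e))) = h (u (Ghost e))"
    if "e \<in> arcs E" for e
    using u that by (simp_all add: leavitt_family_def flip: h.hom_simps(3))
  ultimately show ?thesis
    by (auto simp: leavitt_family_def)
qed

lemma lpa_base_change_map:
  assumes R: "cring R" and S: "cring S" and f: "f \<in> ring_hom R S" and E: "wf_digraph E"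
  obtains \<theta> where
    "\<theta> \<in> algebra_hom R (leavitt_path_algebra R E) (restrict_scalars f (leavitt_path_algebra S E))"
    "\<And>x. x \<in> lpa_gens E \<Longrightarrow> \<theta> (lpa_generator R E x) = lpa_generator S E x"
  by (rule lpa_lift[OF R E restrict_scalars_algebra[OF R f lpa_is_algebra[OF S E]]
        leavitt_family_restrict_scalars[THEN iffD2, OF lpa_generators_leavitt_family[OF S E]]]) blast+

text \<open>
  The two composites \<open>\<Phi> \<circ> \<theta>1\<close> and \<open>\<theta>2 \<circ> \<phi>\<close> are homomorphisms of \<open>R\<close>-algebras into the
  restriction of scalars of \<open>L_S(E2)\<close>.  They agree on generators by the choice of \<open>\<Phi>\<close>.
\<close>

lemma lpa_base_change_hom:
  assumes R: "cring R" and S: "cring S" and f: "f \<in> ring_hom R S"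
    and E1: "wf_digraph E1" and E2: "wf_digraph E2"
    and \<phi>: "\<phi> \<in> algebra_hom R (leavitt_path_algebra R E1) (leavitt_path_algebra R E2)"
    and \<theta>1: "\<theta>1 \<in> algebra_hom R (leavitt_path_algebra R E1) (restrict_scalars f (leavitt_path_algebra S E1))"
    and \<theta>1_gen: "\<And>x. x \<in> lpa_gens E1 \<Longrightarrow> \<theta>1 (lpa_generator R E1 x) = lpa_generator S E1 x"
    and \<theta>2: "\<theta>2 \<in> algebra_hom R (leavitt_path_algebra R E2) (restrict_scalars f (leavitt_path_algebra S E2))"
  obtains \<Phi> where "\<Phi> \<in> algebra_hom S (leavitt_path_algebra S E1) (leavitt_path_algebra S E2)"
    "\<And>a. a \<in> carrier (leavitt_path_algebra R E1) \<Longrightarrow> \<Phi> (\<theta>1 a) = \<theta>2 (\<phi> a)"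
proof -
  let ?L2 = "leavitt_path_algebra S E2"
  have res: "nonunital_algebra R (restrict_scalars f ?L2)"
    by (intro restrict_scalars_algebra[OF R f] lpa_is_algebra S E2)
  have \<theta>\<phi>: "(\<lambda>a. \<theta>2 (\<phi> a)) \<in> algebra_hom R (leavitt_path_algebra R E1) (restrict_scalars f ?L2)"
    by (rule algebra_hom_comp[OF \<phi> \<theta>2])
  have family: "leavitt_family ?L2 E1 (\<lambda>x. \<theta>2 (\<phi> (lpa_generator R E1 x)))"
    using leavitt_family_image[OF lpa_is_algebra[OF R E1] res \<theta>\<phi> E1
        lpa_generators_leavitt_family[OF R E1]] by simp
  obtain \<Phi> where \<Phi>: "\<Phi> \<in> algebra_hom S (leavitt_path_algebra S E1) ?L2"
    and \<Phi>_gen: "\<And>x. x \<in> lpa_gens E1 \<Longrightarrow> \<Phi> (lpa_generator S E1 x) = \<theta>2 (\<phi> (lpa_generator R E1 x))"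
    by (rule lpa_lift[OF S E1 lpa_is_algebra[OF S E2] family]) blast+
  have \<Phi>\<theta>: "(\<lambda>a. \<Phi> (\<theta>1 a)) \<in> algebra_hom R (leavitt_path_algebra R E1) (restrict_scalars f ?L2)"
    by (rule algebra_hom_comp[OF \<theta>1 algebra_hom_restrict_scalars[OF f \<Phi>]])
  have "\<Phi> (\<theta>1 a) = \<theta>2 (\<phi> a)" if "a \<in> carrier (leavitt_path_algebra R E1)" for a
    using that by (rule lpa_hom_eq[OF R E1 res \<Phi>\<theta> \<theta>\<phi>, rotated]) (simp add: \<theta>1_gen \<Phi>_gen)
  then show thesis
    using that \<Phi> by blast
qed

lemma lpa_endomorphism_eq_id:
  assumes "cring S" "wf_digraph E"
    and "h \<in> algebra_hom S (leavitt_path_algebra S E) (leavitt_path_algebra S E)"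
    and "\<And>x. x \<in> lpa_gens E \<Longrightarrow> h (lpa_generator S E x) = lpa_generator S E x"
    and "a \<in> carrier (leavitt_path_algebra S E)"
  shows "h a = a"
  using lpa_hom_eq[OF assms(1,2) lpa_is_algebra[OF assms(1,2)] assms(3) algebra_hom_id assms(4,5)] .

text \<open>
  On a generator \<open>\<theta>1 x\<close> of \<open>L_S(E1)\<close> one computes \<open>\<Psi> (\<Phi> (\<theta>1 x)) = \<Psi> (\<theta>2 (\<phi> x)) =
  \<theta>1 (\<psi> (\<phi> x)) = \<theta>1 x\<close>, and an endomorphism that fixes the generators is the identity.
\<close>

theorem leavitt_path_algebra_isomorphic_base_change:
  assumes R: "cring R" and S: "cring S" and f: "f \<in> ring_hom R S"
    and E1: "wf_digraph E1" and E2: "wf_digraph E2"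
    and iso: "algebra_isomorphic R (leavitt_path_algebra R E1) (leavitt_path_algebra R E2)"
  shows "algebra_isomorphic S (leavitt_path_algebra S E1) (leavitt_path_algebra S E2)"
proof -
  obtain \<phi> \<psi> where \<phi>: "\<phi> \<in> algebra_hom R (leavitt_path_algebra R E1) (leavitt_path_algebra R E2)"
    and \<psi>: "\<psi> \<in> algebra_hom R (leavitt_path_algebra R E2) (leavitt_path_algebra R E1)"
    and \<psi>\<phi>: "\<And>a. a \<in> carrier (leavitt_path_algebra R E1) \<Longrightarrow> \<psi> (\<phi> a) = a"
    and \<phi>\<psi>: "\<And>a. a \<in> carrier (leavitt_path_algebra R E2) \<Longrightarrow> \<phi> (\<psi> a) = a"
    by (rule algebra_isomorphicE[OF iso lpa_is_algebra[OF R E1]]) blast+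
  obtain \<theta>1 where
    \<theta>1: "\<theta>1 \<in> algebra_hom R (leavitt_path_algebra R E1) (restrict_scalars f (leavitt_path_algebra S E1))"
    and \<theta>1_gen: "\<And>x. x \<in> lpa_gens E1 \<Longrightarrow> \<theta>1 (lpa_generator R E1 x) = lpa_generator S E1 x"
    by (rule lpa_base_change_map[OF R S f E1]) blast+
  obtain \<theta>2 where
    \<theta>2: "\<theta>2 \<in> algebra_hom R (leavitt_path_algebra R E2) (restrict_scalars f (leavitt_path_algebra S E2))"
    and \<theta>2_gen: "\<And>x. x \<in> lpa_gens E2 \<Longrightarrow> \<theta>2 (lpa_generator R E2 x) = lpa_generator S E2 x"
    by (rule lpa_base_change_map[OF R S f E2]) blast+
  obtain \<Phi> where \<Phi>: "\<Phi> \<in> algebra_hom S (leavitt_path_algebra S E1) (leavitt_path_algebra S E2)"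
    and \<Phi>\<theta>: "\<And>a. a \<in> carrier (leavitt_path_algebra R E1) \<Longrightarrow> \<Phi> (\<theta>1 a) = \<theta>2 (\<phi> a)"
    by (rule lpa_base_change_hom[OF R S f E1 E2 \<phi> \<theta>1 \<theta>1_gen \<theta>2]) blast+
  obtain \<Psi> where \<Psi>: "\<Psi> \<in> algebra_hom S (leavitt_path_algebra S E2) (leavitt_path_algebra S E1)"
    and \<Psi>\<theta>: "\<And>a. a \<in> carrier (leavitt_path_algebra R E2) \<Longrightarrow> \<Psi> (\<theta>2 a) = \<theta>1 (\<psi> a)"
    by (rule lpa_base_change_hom[OF R S f E2 E1 \<psi> \<theta>2 \<theta>2_gen \<theta>1]) blast+
  note gen1 = leavitt_family_closed[OF lpa_generators_leavitt_family[OF R E1]]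
  note gen2 = leavitt_family_closed[OF lpa_generators_leavitt_family[OF R E2]]
  have "\<Psi> (\<Phi> (lpa_generator S E1 x)) = lpa_generator S E1 x" if x: "x \<in> lpa_gens E1" for x
  proof -
    have "\<Psi> (\<Phi> (lpa_generator S E1 x)) = \<Psi> (\<Phi> (\<theta>1 (lpa_generator R E1 x)))"
      by (simp add: \<theta>1_gen x)
    also have "\<dots> = \<theta>1 (\<psi> (\<phi> (lpa_generator R E1 x)))"
      by (simp add: \<Phi>\<theta> \<Psi>\<theta> gen1 x algebra_homD(1)[OF \<phi>])
    also have "\<dots> = lpa_generator S E1 x"
      by (simp add: \<psi>\<phi> gen1 x \<theta>1_gen)
    finally show ?thesis .
  qed
  then have \<Psi>\<Phi>: "\<Psi> (\<Phi> a) = a" if "a \<in> carrier (leavitt_path_algebra S E1)" for a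
    by (rule lpa_endomorphism_eq_id[OF S E1 algebra_hom_comp[OF \<Phi> \<Psi>] _ that])
  have "\<Phi> (\<Psi> (lpa_generator S E2 x)) = lpa_generator S E2 x" if x: "x \<in> lpa_gens E2" for x
  proof -
    have "\<Phi> (\<Psi> (lpa_generator S E2 x)) = \<Phi> (\<Psi> (\<theta>2 (lpa_generator R E2 x)))"
      by (simp add: \<theta>2_gen x)
    also have "\<dots> = \<theta>2 (\<phi> (\<psi> (lpa_generator R E2 x)))"
      by (simp add: \<Phi>\<theta> \<Psi>\<theta> gen2 x algebra_homD(1)[OF \<psi>])
    also have "\<dots> = lpa_generator S E2 x"
      by (simp add: \<phi>\<psi> gen2 x \<theta>2_gen)
    finally show ?thesis .
  qed
  then have "\<Phi> (\<Psi> a) = a" if "a \<in> carrier (leavitt_path_algebra S E2)" for a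
    by (rule lpa_endomorphism_eq_id[OF S E2 algebra_hom_comp[OF \<Psi> \<Phi>] _ that])
  with \<Phi> \<Psi> \<Psi>\<Phi> show ?thesis
    by (intro algebra_isomorphicI)
qed


section \<open>Units and counits\<close>

lemma (in algebra) unit_ring_hom: "(\<lambda>r. r \<odot>\<^bsub>M\<^esub> \<one>\<^bsub>M\<^esub>) \<in> ring_hom R M"
proof (rule ring_hom_memI)
  fix r s assume rs: "r \<in> carrier R" "s \<in> carrier R"
  then have "(r \<odot>\<^bsub>M\<^esub> \<one>\<^bsub>M\<^esub>) \<otimes>\<^bsub>M\<^esub> (s \<odot>\<^bsub>M\<^esub> \<one>\<^bsub>M\<^esub>) = r \<odot>\<^bsub>M\<^esub> (s \<odot>\<^bsub>M\<^esub> \<one>\<^bsub>M\<^esub>)"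
    by (simp add: smult_assoc2)
  then show "(r \<otimes> s) \<odot>\<^bsub>M\<^esub> \<one>\<^bsub>M\<^esub> = (r \<odot>\<^bsub>M\<^esub> \<one>\<^bsub>M\<^esub>) \<otimes>\<^bsub>M\<^esub> (s \<odot>\<^bsub>M\<^esub> \<one>\<^bsub>M\<^esub>)"
    using rs by (simp add: smult_assoc1)
qed (simp_all add: smult_l_distr)

text \<open>
  One direction is base change along the augmentation \<open>\<epsilon>\<close>, the other along the unit
  \<open>r \<mapsto> r \<cdot> 1\<close>.
\<close>

lemma augmented_algebra_reflects_leavitt_isomorphism:
  assumes A: "algebra K A" and \<epsilon>: "\<epsilon> \<in> ring_hom A K"
    and E1: "wf_digraph E1" and E2: "wf_digraph E2"
  shows "algebra_isomorphic A (leavitt_path_algebra A E1) (leavitt_path_algebra A E2) \<longleftrightarrow>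
    algebra_isomorphic K (leavitt_path_algebra K E1) (leavitt_path_algebra K E2)"
proof -
  interpret algebra K A by fact
  show ?thesis
    using leavitt_path_algebra_isomorphic_base_change[OF M_cring R_cring \<epsilon> E1 E2]
      leavitt_path_algebra_isomorphic_base_change[OF R_cring M_cring unit_ring_hom E1 E2]
    by blast
qed

text \<open>
  The target of the augmentation: it has to be an algebra for the universal property of the monoid
  algebra to apply.
\<close>

definition self_algebra :: "('r, 'm) ring_scheme \<Rightarrow> ('r, 'r) module" where
  "self_algebra R = \<lparr>carrier = carrier R, mult = mult R, one = one R, zero = zero R, add = add R,
     smult = mult R\<rparr>"

lemma self_algebra_is_algebra:
  assumes "cring R"
  shows "nonunital_algebra R (self_algebra R)"
proof -
  interpret cring R by fact
  have "abelian_group (self_algebra R)"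
  proof (rule abelian_groupI)
    fix x assume "x \<in> carrier (self_algebra R)"
    then show "\<exists>y\<in>carrier (self_algebra R). y \<oplus>\<^bsub>self_algebra R\<^esub> x = \<zero>\<^bsub>self_algebra R\<^esub>"
      using l_neg[of x] a_inv_closed[of x] by (auto simp: self_algebra_def)
  qed (simp_all add: self_algebra_def a_ac)
  then have "Module.module R (self_algebra R)"
    by (intro moduleI is_cring) (simp_all add: self_algebra_def l_distr r_distr m_assoc)
  then show ?thesis
    by (intro nonunital_algebra.intro nonunital_algebra_axioms.intro)
      (simp_all add: self_algebra_def l_distr r_distr m_ac)
qed

lemma semigroup_algebra_of_monoid:
  assumes "cring R" "comm_monoid G"
  shows "semigroup_algebra R G"
proof -
  interpret G: comm_monoid G by fact
  show ?thesis
    using assms(1) by (auto simp: semigroup_algebra_def semigroup_algebra_axioms_def G.m_assoc)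
qed

lemma monoid_algebra_is_algebra:
  assumes R: "cring R" and G: "comm_monoid G"
  shows "algebra R (monoid_algebra R G)"
proof -
  interpret G: comm_monoid G by fact
  interpret semigroup_algebra R G
    using assms by (rule semigroup_algebra_of_monoid)
  have one_closed: "\<one>\<^bsub>F\<^esub> \<in> carrier F"
    by (simp add: F_simps)
  have one: "\<one>\<^bsub>F\<^esub> \<otimes>\<^bsub>F\<^esub> p = p" if "p \<in> carrier F" for p
    using that
    by (induction p rule: basis_induct)
      (simp_all add: F_simps(4) F.mult_r_distr F.smult_mult_right basis_mult)
  have comm: "p \<otimes>\<^bsub>F\<^esub> q = q \<otimes>\<^bsub>F\<^esub> p" if p: "p \<in> carrier F" and q: "q \<in> carrier F" for p q
    using p
  proof (induction p rule: basis_induct)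
    case p: (basis r a)
    from q have "basis_elem R a \<otimes>\<^bsub>F\<^esub> q = q \<otimes>\<^bsub>F\<^esub> basis_elem R a"
      by (induction q rule: basis_induct)
        (use p in \<open>simp_all add: F.mult_l_distr F.mult_r_distr F.smult_mult_left
          F.smult_mult_right basis_mult G.m_comm\<close>)
    then show ?case
      using p q by (simp add: F.smult_mult_left F.smult_mult_right)
  qed (use q in \<open>simp_all add: F.mult_l_distr F.mult_r_distr\<close>)
  have "cring F"
    by (intro cringI F.abelian_group_axioms comm_monoidI)
      (auto simp: one_closed one F.mult_assoc F.mult_l_distr intro: comm)
  then show ?thesis
    by (intro algebra.intro algebra_axioms.intro F.module_axioms)
      (simp_all add: F.smult_mult_left)
qed

text \<open>
  The augmentation is the linear extension of the trivial character \<open>g \<mapsto> 1\<close>.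
\<close>

lemma augmentation_ring_hom:
  assumes R: "cring R" and G: "comm_monoid G"
  obtains \<epsilon> where "\<epsilon> \<in> ring_hom (monoid_algebra R G) R"
proof -
  interpret G: comm_monoid G by fact
  interpret semigroup_algebra R G
    using assms by (rule semigroup_algebra_of_monoid)
  let ?\<epsilon> = "linear_extension (self_algebra R) (\<lambda>_. \<one>\<^bsub>R\<^esub>)"
  have "?\<epsilon> \<in> algebra_hom R F (self_algebra R)"
    by (intro linear_extension_hom(1) self_algebra_is_algebra R) (simp_all add: self_algebra_def)
  moreover have "?\<epsilon> (basis_elem R \<one>\<^bsub>G\<^esub>) = \<one>\<^bsub>R\<^esub>"
    by (intro linear_extension_hom(2) self_algebra_is_algebra R) (simp_all add: self_algebra_def)
  ultimately have "?\<epsilon> \<in> ring_hom F R"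
    by (intro ring_hom_memI) (auto simp: algebra_hom_def self_algebra_def F_simps(4))
  then show thesis
    by (rule that)
qed

theorem corollary2p9:
  fixes K :: "('k, 'm) ring_scheme"
    and H :: "('k, 'h) module"
    and comult :: "'h \<Rightarrow> ('h \<times> 'h \<Rightarrow> 'k) set"
    and counit :: "'h \<Rightarrow> 'k"
    and antipode :: "'h \<Rightarrow> 'h"
    and G :: "('g, 'n) monoid_scheme"
    and E1 :: "('v1, 'e1) pre_digraph"
    and E2 :: "('v2, 'e2) pre_digraph"
  assumes "cring K" and "\<one>\<^bsub>K\<^esub> \<noteq> \<zero>\<^bsub>K\<^esub>"
    and "wf_digraph E1" and "wf_digraph E2"
  shows "(comm_hopf_algebra K H comult counit antipode \<longrightarrow>
            (algebra_isomorphic H (leavitt_path_algebra H E1) (leavitt_path_algebra H E2) \<longleftrightarrow>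
             algebra_isomorphic K (leavitt_path_algebra K E1) (leavitt_path_algebra K E2))) \<and>
         (comm_group G \<longrightarrow>
            (algebra_isomorphic (monoid_algebra K G)
               (leavitt_path_algebra (monoid_algebra K G) E1)
               (leavitt_path_algebra (monoid_algebra K G) E2) \<longleftrightarrow>
             algebra_isomorphic K (leavitt_path_algebra K E1) (leavitt_path_algebra K E2)))"
proof (intro conjI impI)
  assume "comm_hopf_algebra K H comult counit antipode"
  then interpret comm_hopf_algebra K H comult counit antipode .
  show "algebra_isomorphic H (leavitt_path_algebra H E1) (leavitt_path_algebra H E2) \<longleftrightarrow>
      algebra_isomorphic K (leavitt_path_algebra K E1) (leavitt_path_algebra K E2)"
    by (rule augmented_algebra_reflects_leavitt_isomorphism[OF algebra_axioms counit_ring_hom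
          assms(3,4)])
next
  assume "comm_group G"
  then have G: "comm_monoid G"
    by (rule comm_group.axioms)
  obtain \<epsilon> where \<epsilon>: "\<epsilon> \<in> ring_hom (monoid_algebra K G) K"
    using assms(1) G by (rule augmentation_ring_hom)
  show "algebra_isomorphic (monoid_algebra K G) (leavitt_path_algebra (monoid_algebra K G) E1)
        (leavitt_path_algebra (monoid_algebra K G) E2) \<longleftrightarrow>
      algebra_isomorphic K (leavitt_path_algebra K E1) (leavitt_path_algebra K E2)"
    by (rule augmented_algebra_reflects_leavitt_isomorphism[OF
          monoid_algebra_is_algebra[OF assms(1) G] \<epsilon> assms(3,4)])
qed

end
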